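(* Let $I$ be a square-free monomial ideal in $S=k[x_1,\dots,x_n]$, $k$ a field, and let $D(I)$ be its Alexander dual ideal. If $\widetilde I\subseteq \widetilde S$ is a polarization of $I$, then the Alexander dual $D(\widetilde I)\subseteq\widetilde S$ is a polarization of $D(I)$.
   Context: Polarization: Let $J$ be a monomial ideal in $S=k[x_1,\dots,x_n]$. A polarization of $J$ is a square-free monomial ideal $\widetilde J$ in $\widetilde S=k[x_i^{(j)} : 1\le i\le n,\ 1\le j\le r_i]$ such that the sequence $\sigma$ consisting of all $x_i^{(1)}-x_i^{(j)}$ ($1\le i\le n$, $2\le j\le r_i$) is a regular $\widetilde S/\widetilde J$-sequence and $\widetilde J\otimes \widetilde S/(\sigma)\cong J$ (that is, substituting $x_i^{(j)}\mapsto x_i$ carries $\widetilde J$ to $J$). Alexander dual: if a square-free monomial ideal $I$ in a polynomial ring is generated by square-free monomials $m_{\sigma_j}=\prod_{i\in\sigma_j}x_i$, then $D(I)$ is the ideal of the same ring generated by the monomials $n_\tau=\prod_{i\in\tau}x_i$ for all sets $\tau$ of variable indices with $\tau\cap\sigma_j\ne\emptyset$ for all $j$. The Alexander dual of $\widetilde I$ is taken in $\widetilde S$, with respect to all its variables $x_i^{(j)}$. *)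

theory Defs
  imports "HOL-Library.Poly_Mapping" "HOL-Algebra.QuotRing" "HOL-Algebra.Module"
begin

section \<open>Polynomial rings\<close>

text \<open>An element of \<open>('v \<Rightarrow>\<^sub>0 nat) \<Rightarrow>\<^sub>0 'k\<close> maps each exponent vector to its coefficient;
  the product of \<^theory>\<open>HOL-Library.Poly_Mapping\<close> is multiplication of polynomials.\<close>

type_synonym ('v, 'k) mpoly = "('v \<Rightarrow>\<^sub>0 nat) \<Rightarrow>\<^sub>0 'k"

definition poly_ring :: "'v set \<Rightarrow> ('v, 'k::field) mpoly ring" where
  "poly_ring V =
    \<lparr>carrier = {p. \<forall>m \<in> Poly_Mapping.keys p. Poly_Mapping.keys m \<subseteq> V},
     monoid.mult = (*), one = 1, zero = 0, add = (+)\<rparr>"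

definition pvar :: "'v \<Rightarrow> ('v, 'k::field) mpoly" where
  "pvar v = Poly_Mapping.single (Poly_Mapping.single v 1) 1"

text \<open>The \<open>'k\<close>-algebra homomorphism sending each variable \<open>v\<close> to the polynomial \<open>f v\<close>.\<close>

definition psubst :: "('v \<Rightarrow> ('w, 'k) mpoly) \<Rightarrow> ('v, 'k::field) mpoly \<Rightarrow> ('w, 'k) mpoly" where
  "psubst f p = (\<Sum>m \<in> Poly_Mapping.keys p.
     Poly_Mapping.single 0 (Poly_Mapping.lookup p m) *
       (\<Prod>v \<in> Poly_Mapping.keys m. f v ^ Poly_Mapping.lookup m v))"

lemma cring_poly_ring: "cring (poly_ring V :: ('v, 'k::field) mpoly ring)"
proof -
  let ?C = "{p :: ('v, 'k) mpoly. \<forall>m \<in> Poly_Mapping.keys p. Poly_Mapping.keys m \<subseteq> V}"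
  have add: "p + q \<in> ?C" if "p \<in> ?C" "q \<in> ?C" for p q
    using that Poly_Mapping.keys_add[of p q] by blast
  have neg: "- p \<in> ?C" if "p \<in> ?C" for p
    using that by (simp add: in_keys_iff)
  have mult: "p * q \<in> ?C" if "p \<in> ?C" "q \<in> ?C" for p q
  proof clarify
    fix m x assume m: "m \<in> Poly_Mapping.keys (p * q)" and x: "x \<in> Poly_Mapping.keys m"
    from m obtain a b where "m = a + b" "a \<in> Poly_Mapping.keys p" "b \<in> Poly_Mapping.keys q"
      using keys_mult[of p q] by blast
    then show "x \<in> V" using that x Poly_Mapping.keys_add[of a b] by blast
  qed
  have zero: "0 \<in> ?C" and one: "1 \<in> ?C" by auto
  define C where "C = ?C"
  note closed = add neg mult zero one
  have ring: "poly_ring V = \<lparr>carrier = C, monoid.mult = (*), one = 1, zero = 0, add = (+)\<rparr>"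
    by (simp add: poly_ring_def C_def)
  note closed = closed[folded C_def]
  show ?thesis
  proof (rule cringI)
    show "abelian_group (poly_ring V :: ('v, 'k) mpoly ring)"
      by (rule abelian_groupI)
        (auto simp: ring closed ac_simps intro: bexI[OF _ closed(2)])
    show "comm_monoid (poly_ring V :: ('v, 'k) mpoly ring)"
      by (rule comm_monoidI) (auto simp: ring closed ac_simps)
  qed (simp add: ring algebra_simps)
qed

section \<open>Monomial ideals and Alexander duality\<close>

definition monomial_ideal :: "'v set \<Rightarrow> ('v, 'k::field) mpoly set \<Rightarrow> bool" where
  "monomial_ideal V J \<longleftrightarrow>
    (\<exists>A \<subseteq> {m. Poly_Mapping.keys m \<subseteq> V}.
       J = Idl\<^bsub>poly_ring V\<^esub> ((\<lambda>m. Poly_Mapping.single m 1) ` A))"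

definition sqfree_monomial :: "'v set \<Rightarrow> ('v, 'k::field) mpoly" where
  "sqfree_monomial \<sigma> = (\<Prod>v \<in> \<sigma>. pvar v)"

definition sqfree_monomial_ideal :: "'v set \<Rightarrow> ('v, 'k::field) mpoly set \<Rightarrow> bool" where
  "sqfree_monomial_ideal V J \<longleftrightarrow> (\<exists>F \<subseteq> Pow V. J = Idl\<^bsub>poly_ring V\<^esub> (sqfree_monomial ` F))"

text \<open>The dual is formed from the generating set of all square-free monomials in \<open>I\<close>;
  by \<open>alexander_dual_Idl\<close> below any other set of square-free monomials generating \<open>I\<close>
  gives the same ideal.\<close>

definition alexander_dual :: "'v set \<Rightarrow> ('v, 'k::field) mpoly set \<Rightarrow> ('v, 'k) mpoly set" where
  "alexander_dual V I = Idl\<^bsub>poly_ring V\<^esub> (sqfree_monomial `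
     {\<tau>. \<tau> \<subseteq> V \<and> (\<forall>\<sigma> \<subseteq> V. sqfree_monomial \<sigma> \<in> I \<longrightarrow> \<tau> \<inter> \<sigma> \<noteq> {})})"

lemma sqfree_monomial_eq_single:
  assumes "finite \<sigma>"
  shows "sqfree_monomial \<sigma> =
    Poly_Mapping.single (\<Sum>v\<in>\<sigma>. Poly_Mapping.single v 1) (1::'k::field)"
  using assms by (induction \<sigma>) (auto simp: sqfree_monomial_def pvar_def mult_single)

lemma keys_sum_single:
  assumes "finite \<sigma>"
  shows "Poly_Mapping.keys (\<Sum>v\<in>\<sigma>. Poly_Mapping.single v (1::nat)) = \<sigma>"
proof -
  have "Poly_Mapping.lookup (\<Sum>v\<in>\<sigma>. Poly_Mapping.single v (1::nat)) x = (if x \<in> \<sigma> then 1 else 0)" for x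
    using assms by (simp add: lookup_sum lookup_single when_def)
  then show ?thesis by (auto simp: in_keys_iff simp del: One_nat_def split: if_splits)
qed

lemma keys_sqfree_monomial:
  assumes "finite \<sigma>"
  shows "Poly_Mapping.keys (sqfree_monomial \<sigma> :: ('v, 'k::field) mpoly) =
    {\<Sum>v\<in>\<sigma>. Poly_Mapping.single v 1}"
  using assms by (simp add: sqfree_monomial_eq_single)

lemma ideal_sqfree_multiples:
  assumes "finite V" "F \<subseteq> Pow V"
  shows "ideal {p \<in> carrier (poly_ring V :: ('v, 'k::field) mpoly ring).
    \<forall>m \<in> Poly_Mapping.keys p. \<exists>\<sigma>\<in>F. \<sigma> \<subseteq> Poly_Mapping.keys m} (poly_ring V)"
    (is "ideal ?K ?P")
proof -
  interpret cring ?P by (rule cring_poly_ring)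
  have neg: "\<ominus>\<^bsub>?P\<^esub> p = - p" if p: "p \<in> carrier ?P" for p
  proof (rule minus_equality)
    show "- p \<in> carrier ?P" using p by (simp add: poly_ring_def in_keys_iff)
    then show "- p \<oplus>\<^bsub>?P\<^esub> p = \<zero>\<^bsub>?P\<^esub>" by (simp add: poly_ring_def)
  qed (fact p)
  have mult: "a * x \<in> ?K" if a: "a \<in> ?K" and x: "x \<in> carrier ?P" for a x
  proof -
    have c: "a * x \<in> carrier ?P" using m_closed[of a x] that by (simp add: poly_ring_def)
    have "\<exists>\<sigma>\<in>F. \<sigma> \<subseteq> Poly_Mapping.keys m" if m: "m \<in> Poly_Mapping.keys (a * x)" for m
    proof -
      obtain s t where st: "m = s + t" "s \<in> Poly_Mapping.keys a"
        using m keys_mult[of a x] by blast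
      then obtain \<sigma> where "\<sigma> \<in> F" "\<sigma> \<subseteq> Poly_Mapping.keys s" using a by blast
      moreover have "Poly_Mapping.keys s \<subseteq> Poly_Mapping.keys m"
        using st(1) by (auto simp: in_keys_iff lookup_add)
      ultimately show ?thesis by blast
    qed
    with c show ?thesis by blast
  qed
  show ?thesis
  proof (rule idealI)
    show "ring ?P" by (rule ring_axioms)
    show "subgroup ?K (add_monoid ?P)"
    proof (rule add.subgroupI)
      show "?K \<noteq> {}" by (auto intro!: exI[of _ 0] simp: poly_ring_def)
      fix a assume a: "a \<in> ?K"
      then show "\<ominus>\<^bsub>?P\<^esub> a \<in> ?K" using neg[of a] a_inv_closed[of a] by (auto simp: in_keys_iff)
      fix b assume b: "b \<in> ?K"
      have "a + b \<in> carrier ?P" using a b a_closed[of a b] by (simp add: poly_ring_def)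
      moreover have "\<exists>\<sigma>\<in>F. \<sigma> \<subseteq> Poly_Mapping.keys m" if m: "m \<in> Poly_Mapping.keys (a + b)" for m
        using subsetD[OF Poly_Mapping.keys_add m] a b by auto
      ultimately show "a \<oplus>\<^bsub>?P\<^esub> b \<in> ?K" by (simp add: poly_ring_def)
    qed blast
    fix a x assume "a \<in> ?K" "x \<in> carrier ?P"
    from mult[OF this] show "a \<otimes>\<^bsub>?P\<^esub> x \<in> ?K" "x \<otimes>\<^bsub>?P\<^esub> a \<in> ?K"
      by (simp_all add: poly_ring_def mult.commute)
  qed
qed

lemma sqfree_monomial_in_carrier:
  assumes "finite V" "\<sigma> \<subseteq> V"
  shows "sqfree_monomial \<sigma> \<in> carrier (poly_ring V :: ('v, 'k::field) mpoly ring)"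
  using assms finite_subset[OF assms(2,1)]
  by (simp add: poly_ring_def keys_sqfree_monomial keys_sum_single del: One_nat_def)

lemma sqfree_monomial_in_Idl:
  assumes V: "finite V" "F \<subseteq> Pow V" "\<sigma> \<subseteq> V"
  shows "(sqfree_monomial \<sigma> :: ('v, 'k::field) mpoly) \<in> Idl\<^bsub>poly_ring V\<^esub> (sqfree_monomial ` F)
    \<longleftrightarrow> (\<exists>\<sigma>'\<in>F. \<sigma>' \<subseteq> \<sigma>)" (is "?m \<in> ?I \<longleftrightarrow> _")
proof
  let ?P = "poly_ring V :: ('v, 'k) mpoly ring"
  interpret cring ?P by (rule cring_poly_ring)
  have sub: "sqfree_monomial ` F \<subseteq> carrier ?P" using V sqfree_monomial_in_carrier by blast
  have fin: "finite \<tau>" if "\<tau> \<subseteq> V" for \<tau> using that V(1) finite_subset by blast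
  {
    assume "?m \<in> ?I"
    moreover have "?I \<subseteq> {p \<in> carrier ?P.
        \<forall>m \<in> Poly_Mapping.keys p. \<exists>\<sigma>\<in>F. \<sigma> \<subseteq> Poly_Mapping.keys m}" (is "_ \<subseteq> ?K")
    proof (rule genideal_minimal[OF ideal_sqfree_multiples[OF V(1,2)]])
      show "sqfree_monomial ` F \<subseteq> ?K"
      proof clarify
        fix \<tau> assume \<tau>: "\<tau> \<in> F"
        with V fin have f: "finite \<tau>" by blast
        show "sqfree_monomial \<tau> \<in> carrier ?P \<and>
          (\<forall>m\<in>Poly_Mapping.keys (sqfree_monomial \<tau> :: ('v, 'k) mpoly). \<exists>\<sigma>\<in>F. \<sigma> \<subseteq> Poly_Mapping.keys m)"
          using \<tau> f sub by (auto simp: keys_sqfree_monomial keys_sum_single simp del: One_nat_def)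
      qed
    qed
    ultimately show "\<exists>\<sigma>'\<in>F. \<sigma>' \<subseteq> \<sigma>"
      using fin[OF V(3)] by (auto simp: keys_sqfree_monomial keys_sum_single simp del: One_nat_def)
  }
  {
    assume "\<exists>\<sigma>'\<in>F. \<sigma>' \<subseteq> \<sigma>"
    then obtain \<sigma>' where s: "\<sigma>' \<in> F" "\<sigma>' \<subseteq> \<sigma>" by blast
    have id: "ideal ?I ?P" by (rule genideal_ideal[OF sub])
    have "sqfree_monomial (\<sigma> - \<sigma>') \<otimes>\<^bsub>?P\<^esub> sqfree_monomial \<sigma>' \<in> ?I"
      using V s genideal_self[OF sub]
      by (intro ideal.I_l_closed[OF id] sqfree_monomial_in_carrier) auto
    moreover have "sqfree_monomial (\<sigma> - \<sigma>') \<otimes>\<^bsub>?P\<^esub> sqfree_monomial \<sigma>' = ?m"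
      using prod.subset_diff[OF s(2) fin[OF V(3)], of "pvar :: _ \<Rightarrow> ('v, 'k) mpoly"]
      by (simp only: poly_ring_def sqfree_monomial_def monoid.simps)
    ultimately show "?m \<in> ?I" by simp
  }
qed

lemma alexander_dual_Idl:
  assumes "finite V" "F \<subseteq> Pow V"
  shows "alexander_dual V (Idl\<^bsub>poly_ring V\<^esub> (sqfree_monomial ` F) :: ('v, 'k::field) mpoly set) =
    Idl\<^bsub>poly_ring V\<^esub> (sqfree_monomial ` {\<tau>. \<tau> \<subseteq> V \<and> (\<forall>\<sigma>\<in>F. \<tau> \<inter> \<sigma> \<noteq> {})})"
proof -
  have "(\<forall>\<sigma>\<subseteq>V. (sqfree_monomial \<sigma> :: ('v, 'k) mpoly) \<in> Idl\<^bsub>poly_ring V\<^esub> (sqfree_monomial ` F)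
      \<longrightarrow> \<tau> \<inter> \<sigma> \<noteq> {}) \<longleftrightarrow> (\<forall>\<sigma>\<in>F. \<tau> \<inter> \<sigma> \<noteq> {})" for \<tau>
    using assms(2) by (auto simp: sqfree_monomial_in_Idl[OF assms] simp del: not_ex) blast+
  then show ?thesis by (simp add: alexander_dual_def)
qed

section \<open>Regular sequences on a module\<close>

definition quotient_module :: "('a, 'c) ring_scheme \<Rightarrow> 'a set \<Rightarrow> ('a, 'a set) module" where
  "quotient_module R J =
    \<lparr>carrier = carrier (R Quot J), monoid.mult = monoid.mult (R Quot J), one = one (R Quot J),
     zero = zero (R Quot J), add = add (R Quot J),
     smult = (\<lambda>r X. (J +>\<^bsub>R\<^esub> r) \<otimes>\<^bsub>R Quot J\<^esub> X)\<rparr>"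

text \<open>For \<open>fs = [f\<^sub>1, \<dots>, f\<^sub>k]\<close> this is the submodule \<open>(f\<^sub>1, \<dots>, f\<^sub>k)M\<close>.\<close>

definition list_smult :: "'a list \<Rightarrow> ('a, 'b, 'c) module_scheme \<Rightarrow> 'b set" where
  "list_smult fs M =
    {(\<Oplus>\<^bsub>M\<^esub>k\<in>{..<length fs}. fs ! k \<odot>\<^bsub>M\<^esub> x k) | x. x \<in> {..<length fs} \<rightarrow> carrier M}"

text \<open>\<open>f\<^sub>k\<close> is a nonzerodivisor on \<open>M/(f\<^sub>1, \<dots>, f\<^bsub>k-1\<^esub>)M\<close> for every \<open>k\<close>. The condition
  \<open>(f\<^sub>1, \<dots>, f\<^sub>n)M \<noteq> M\<close> is not imposed, so that every sequence is regular on the zero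
  module: otherwise the unit ideal, which is the dual of the zero ideal, would have no
  polarization. For quotients by proper square-free monomial ideals the condition holds
  automatically, see \<open>polarization_sequence_proper\<close>.\<close>

definition regular_sequence ::
    "('a, 'd) ring_scheme \<Rightarrow> ('a, 'b, 'c) module_scheme \<Rightarrow> 'a list \<Rightarrow> bool" where
  "regular_sequence R M fs \<longleftrightarrow> set fs \<subseteq> carrier R \<and>
    (\<forall>k < length fs. \<forall>x \<in> carrier M.
       fs ! k \<odot>\<^bsub>M\<^esub> x \<in> list_smult (take k fs) M \<longrightarrow> x \<in> list_smult (take k fs) M)"

lemma quotient_module_module:
  assumes "cring R" "ideal J R"
  shows "module R (quotient_module R J)"
proof -
  interpret R: cring R by fact
  interpret J: ideal J R by fact
  interpret Q: cring "R Quot J" by (rule J.quotient_is_cring[OF assms(1)])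
  interpret h: ring_hom_ring R "R Quot J" "(+>\<^bsub>R\<^esub>) J" by (rule J.rcos_ring_hom_ring)
  have ab: "abelian_group (quotient_module R J)"
    by (rule abelian_groupI, simp_all add: quotient_module_def Q.a_assoc Q.add.l_inv_ex[simplified])
      (erule (1) Q.a_comm)
  show ?thesis
    by (rule moduleI[OF assms(1) ab])
      (auto simp: quotient_module_def Q.l_distr Q.r_distr Q.m_assoc)
qed

section \<open>Polarization\<close>

text \<open>The pair \<open>(i, j)\<close> stands for the variable \<open>x\<^sub>i\<^sup>(\<^sup>j\<^sup>)\<close>.\<close>

definition pol_vars :: "nat \<Rightarrow> (nat \<Rightarrow> nat) \<Rightarrow> (nat \<times> nat) set" where
  "pol_vars n r = {(i, j). i \<in> {1..n} \<and> j \<in> {1..r i}}"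

definition pol_sequence :: "nat \<Rightarrow> (nat \<Rightarrow> nat) \<Rightarrow> (nat \<times> nat, 'k::field) mpoly list" where
  "pol_sequence n r =
    concat (map (\<lambda>i. map (\<lambda>j. pvar (i, 1) - pvar (i, j)) [2..<Suc (r i)]) [1..<Suc n])"

definition polarization :: "nat \<Rightarrow> (nat \<Rightarrow> nat) \<Rightarrow> (nat, 'k::field) mpoly set \<Rightarrow>
    (nat \<times> nat, 'k) mpoly set \<Rightarrow> bool" where
  "polarization n r J J' \<longleftrightarrow>
    (\<forall>i \<in> {1..n}. r i \<ge> 1) \<and>
    monomial_ideal {1..n} J \<and>
    sqfree_monomial_ideal (pol_vars n r) J' \<and>
    regular_sequence (poly_ring (pol_vars n r))
      (quotient_module (poly_ring (pol_vars n r)) J') (pol_sequence n r) \<and>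
    psubst (\<lambda>(i, j). pvar i) ` J' = J"

lemma list_smult_quotient_proper:
  assumes R: "cring R" and J: "ideal J R" and m: "ideal \<mm> R" "\<mm> \<noteq> carrier R"
    and sub: "J \<subseteq> \<mm>" "set fs \<subseteq> \<mm>"
  shows "list_smult fs (quotient_module R J) \<noteq> carrier (quotient_module R J)"
proof -
  interpret R: cring R by fact
  interpret J: ideal J R by fact
  interpret m: ideal \<mm> R by fact
  let ?M = "quotient_module R J"
  interpret M: module R ?M by (rule quotient_module_module[OF R J])
  have coset: "\<exists>a\<in>carrier R. X = J +>\<^bsub>R\<^esub> a" if "X \<in> carrier ?M" for X
    using that by (auto simp: quotient_module_def FactRing_simps)
  have inm: "J +>\<^bsub>R\<^esub> a \<subseteq> \<mm>" if "a \<in> \<mm>" for a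
    using that sub by (auto simp: a_r_coset_def' intro: m.a_closed)
  have self: "a \<in> J +>\<^bsub>R\<^esub> a" if "a \<in> carrier R" for a
    using that by (rule J.a_rcos_self)
  have smul: "f \<odot>\<^bsub>?M\<^esub> X \<subseteq> \<mm>" if "f \<in> \<mm>" "X \<in> carrier ?M" for f X
  proof -
    obtain a where a: "a \<in> carrier R" "X = J +>\<^bsub>R\<^esub> a" using coset \<open>X \<in> _\<close> by blast
    have f: "f \<in> carrier R" using \<open>f \<in> \<mm>\<close> m.a_subset by blast
    have "f \<odot>\<^bsub>?M\<^esub> X = J +>\<^bsub>R\<^esub> (f \<otimes>\<^bsub>R\<^esub> a)"
      using a f by (simp add: quotient_module_def FactRing_def J.rcoset_mult_add)
    then show ?thesis using inm[of "f \<otimes>\<^bsub>R\<^esub> a"] m.I_r_closed a \<open>f \<in> \<mm>\<close> by simp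
  qed
  have add: "X \<oplus>\<^bsub>?M\<^esub> Y \<subseteq> \<mm>" if XY: "X \<in> carrier ?M" "Y \<in> carrier ?M" "X \<subseteq> \<mm>" "Y \<subseteq> \<mm>" for X Y
    using XY m.a_closed by (auto simp: quotient_module_def FactRing_def set_add_def')
  have fin: "(\<Oplus>\<^bsub>?M\<^esub>k\<in>A. fs ! k \<odot>\<^bsub>?M\<^esub> x k) \<subseteq> \<mm>"
    if "finite A" "A \<subseteq> {..<length fs}" "x \<in> A \<rightarrow> carrier ?M" for A x
    using that
  proof (induction A)
    case empty
    have "zero ?M = J" by (simp add: quotient_module_def FactRing_def)
    then show ?case using sub by simp
  next
    case (insert k A)
    have mem: "fs ! j \<in> \<mm>" "fs ! j \<in> carrier R" if "j \<in> insert k A" for j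
      using that insert.prems sub m.a_subset by (auto simp: subset_iff)
    have cl: "(\<lambda>k. fs ! k \<odot>\<^bsub>?M\<^esub> x k) \<in> A \<rightarrow> carrier ?M" "fs ! k \<odot>\<^bsub>?M\<^esub> x k \<in> carrier ?M"
      using insert.prems mem by auto
    then show ?case
      using insert mem smul[of "fs ! k" "x k"]
      by (subst M.finsum_insert) (auto intro!: add M.finsum_closed del: subsetI)
  qed
  have "X \<subseteq> \<mm>" if "X \<in> list_smult fs ?M" for X
    using that fin[of "{..<length fs}"] unfolding list_smult_def by blast
  moreover have "J +>\<^bsub>R\<^esub> \<one>\<^bsub>R\<^esub> \<in> carrier ?M"
    by (auto simp: quotient_module_def FactRing_simps)
  moreover have "\<one>\<^bsub>R\<^esub> \<notin> \<mm>" using m m.one_imp_carrier by blast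
  ultimately show ?thesis using self[OF R.one_closed] by blast
qed

lemma polarization_sequence_proper:
  fixes J :: "(nat \<times> nat, 'k::field) mpoly set"
    and n :: nat and r :: "nat \<Rightarrow> nat"
  defines "P \<equiv> poly_ring (pol_vars n r)"
  assumes J: "sqfree_monomial_ideal (pol_vars n r) J" and ne: "J \<noteq> carrier P"
  shows "list_smult (pol_sequence n r) (quotient_module P J) \<noteq> carrier (quotient_module P J)"
proof -
  let ?V = "pol_vars n r"
  interpret cring P unfolding P_def by (rule cring_poly_ring)
  have "?V = Sigma {1..n} (\<lambda>i. {1..r i})" by (auto simp: pol_vars_def)
  then have V: "finite ?V" by simp
  define \<mm> :: "(nat \<times> nat, 'k) mpoly set" where
    "\<mm> = {p \<in> carrier P. \<forall>m \<in> Poly_Mapping.keys p.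
       \<exists>\<sigma>\<in>(\<lambda>v. {v}) ` ?V. \<sigma> \<subseteq> Poly_Mapping.keys m}"
  have m: "ideal \<mm> P"
    unfolding \<mm>_def P_def by (rule ideal_sqfree_multiples[OF V]) auto
  have "1 \<in> carrier P" "1 \<notin> \<mm>" by (auto simp: P_def \<mm>_def poly_ring_def)
  then have m1: "\<mm> \<noteq> carrier P" by blast
  obtain F where F: "F \<subseteq> Pow ?V" "J = Idl\<^bsub>P\<^esub> (sqfree_monomial ` F)"
    using J unfolding sqfree_monomial_ideal_def P_def by blast
  have sub: "sqfree_monomial ` F \<subseteq> carrier P"
    using F V sqfree_monomial_in_carrier unfolding P_def by blast
  have id: "ideal J P" using genideal_ideal[OF sub] F by simp
  have "{} \<notin> F"
  proof
    assume "{} \<in> F"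
    then have "sqfree_monomial {} \<in> J" using genideal_self[OF sub] F by blast
    then have "\<one>\<^bsub>P\<^esub> \<in> J" by (simp add: sqfree_monomial_def P_def poly_ring_def)
    then show False using ideal.one_imp_carrier[OF id] ne by simp
  qed
  have "sqfree_monomial \<sigma> \<in> \<mm>" if s: "\<sigma> \<in> F" for \<sigma>
  proof -
    have "finite \<sigma>" "\<sigma> \<subseteq> ?V" using s F V finite_subset by blast+
    moreover have "\<sigma> \<noteq> {}" using s \<open>{} \<notin> F\<close> by metis
    then obtain v where "v \<in> \<sigma>" by blast
    ultimately show ?thesis using s sub
      by (auto simp: \<mm>_def keys_sqfree_monomial keys_sum_single simp del: One_nat_def)
  qed
  then have Jm: "J \<subseteq> \<mm>" unfolding F by (intro genideal_minimal[OF m]) blast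
  have "set (pol_sequence n r) \<subseteq> \<mm>"
  proof
    fix f :: "(nat \<times> nat, 'k) mpoly" assume "f \<in> set (pol_sequence n r)"
    then obtain i j where f: "f = pvar (i, 1) - pvar (i, j)" and ij: "(i, 1) \<in> ?V" "(i, j) \<in> ?V"
      by (auto simp: pol_sequence_def pol_vars_def)
    have "Poly_Mapping.keys f \<subseteq> {Poly_Mapping.single (i, 1) 1, Poly_Mapping.single (i, j) 1}"
      using keys_diff[of "pvar (i, 1)" "pvar (i, j)"] unfolding f
      by (auto simp: pvar_def)
    then show "f \<in> \<mm>" using ij by (auto simp: \<mm>_def P_def poly_ring_def)
  qed
  then show ?thesis
    using list_smult_quotient_proper[OF cring_axioms id m m1 Jm] by blast
qed

end

theory Submission
  imports Defs
begin

text \<open>Let \<open>U\<close> be the family of supports of the monomials in \<open>I'\<close>. For a square-free monomial ideal \<open>I\<close>,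
  \<open>I'\<close> polarizes its image \<open>I\<close> iff neither a minimal generator of \<open>I'\<close> nor a minimal vertex cover of
  its generators, that is, a minimal generator of the dual, contains two variables over the same
  \<open>x\<^sub>i\<close>. This condition is symmetric under duality, which replaces \<open>U\<close> by the complements of the sets
  that are not in \<open>U\<close>.

  If \<open>I'\<close> is a polarization, then \<open>I' \<inter> (\<sigma>) = (\<sigma>) I'\<close>, so minimal generators of \<open>I'\<close> stay minimal
  modulo \<open>(\<sigma>)\<close> and have square-free image. Since the ideals are graded, a difference of any two variables
  over \<open>x\<^sub>i\<close> is a nonzerodivisor modulo \<open>I'\<close>, whereas for \<open>u\<close>, \<open>v\<close> in a minimal cover, \<open>u - v\<close> kills the
  product of the variables outside the cover. Conversely, the condition survives the identification
  of variables one at a time, and \<open>x - y\<close> is a nonzerodivisor modulo a square-free monomial ideal if no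
  minimal cover contains both \<open>x\<close> and \<open>y\<close>.\<close>

section \<open>Modules over a subring and regular sequences\<close>

text \<open>Rings are encoded as subsets \<open>C\<close> of a type, because
  \<open>poly_ring V\<close> lives inside the type of all polynomials. An ideal of \<open>C\<close>
  is a submodule contained in \<open>C\<close>.\<close>

definition submodule :: "'a::comm_ring_1 set \<Rightarrow> 'a set \<Rightarrow> bool" where
  "submodule C M \<longleftrightarrow> 0 \<in> M \<and> (\<forall>p\<in>M. \<forall>q\<in>M. p + q \<in> M) \<and> (\<forall>c\<in>C. \<forall>p\<in>M. c * p \<in> M)"

text \<open>The condition \<open>- 1 \<in> C\<close> yields closure under negation, for
  \<open>C\<close> and for its submodules.\<close>

definition subring_set :: "'a::comm_ring_1 set \<Rightarrow> bool" where
  "subring_set C \<longleftrightarrow> submodule C C \<and> 1 \<in> C \<and> - 1 \<in> C"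

definition nonzerodivisor_mod :: "'a::comm_ring_1 set \<Rightarrow> 'a set \<Rightarrow> 'a \<Rightarrow> bool" where
  "nonzerodivisor_mod C M f \<longleftrightarrow> (\<forall>p\<in>C. f * p \<in> M \<longrightarrow> p \<in> M)"

text \<open>The sum M + f 0 N + ... + f (k - 1) N. With N = C it is M plus the ideal of the first k
  elements; with M = 0 and N an ideal it is the product of that ideal with N.\<close>

primrec plus_span :: "'a::comm_ring_1 set \<Rightarrow> 'a set \<Rightarrow> (nat \<Rightarrow> 'a) \<Rightarrow> nat \<Rightarrow> 'a set" where
  "plus_span M N f 0 = M"
| "plus_span M N f (Suc k) = {p + f k * h | p h. p \<in> plus_span M N f k \<and> h \<in> N}"

lemma submoduleD:
  assumes "submodule C M"
  shows "0 \<in> M" "\<And>p q. p \<in> M \<Longrightarrow> q \<in> M \<Longrightarrow> p + q \<in> M" "\<And>c p. c \<in> C \<Longrightarrow> p \<in> M \<Longrightarrow> c * p \<in> M"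
  using assms by (auto simp: submodule_def)

lemma submodule_uminus:
  assumes "subring_set C" "submodule C M" "p \<in> M"
  shows "- p \<in> M"
  using submoduleD(3)[OF assms(2), of "- 1" p] assms by (simp add: subring_set_def)

lemma submodule_diff:
  assumes "subring_set C" "submodule C M" "p \<in> M" "q \<in> M"
  shows "p - q \<in> M"
  using submoduleD(2)[OF assms(2,3) submodule_uminus[OF assms(1,2,4)]] by simp

lemma submodule_power:
  assumes "subring_set C" "g \<in> C" "p \<in> C"
  shows "g ^ t * p \<in> C"
proof (induction t)
  case (Suc t)
  then show ?case
    using submoduleD(3)[of C C g "g ^ t * p"] assms by (simp add: subring_set_def mult.assoc)
qed (use assms in auto)

lemma submodule_zero: "submodule C {0}"
  by (simp add: submodule_def)

lemma submodule_plus_span: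
  assumes "submodule C M" "submodule C N"
  shows "submodule C (plus_span M N f k)"
proof (induction k)
  case (Suc k)
  note D = submoduleD[OF Suc] submoduleD[OF assms(2)]
  have "\<exists>p h. 0 = p + f k * h \<and> p \<in> plus_span M N f k \<and> h \<in> N"
    using D by (intro exI[of _ 0]) auto
  moreover have "\<exists>p h. (p1 + f k * h1) + (p2 + f k * h2) = p + f k * h \<and> p \<in> plus_span M N f k \<and> h \<in> N"
    if "p1 \<in> plus_span M N f k" "h1 \<in> N" "p2 \<in> plus_span M N f k" "h2 \<in> N" for p1 h1 p2 h2
    using D that by (intro exI[of _ "p1 + p2"] exI[of _ "h1 + h2"]) (auto simp: algebra_simps)
  moreover have "\<exists>p h. c * (p1 + f k * h1) = p + f k * h \<and> p \<in> plus_span M N f k \<and> h \<in> N"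
    if "p1 \<in> plus_span M N f k" "h1 \<in> N" "c \<in> C" for c p1 h1
    using D that by (intro exI[of _ "c * p1"] exI[of _ "c * h1"]) (auto simp: algebra_simps)
  ultimately show ?case by (auto simp: submodule_def)
qed (use assms in simp)

lemma plus_span_mono:
  assumes "submodule C N" "i \<le> k" shows "plus_span M N f i \<subseteq> plus_span M N f k"
  using assms(2)
proof (induction rule: dec_induct)
  case (step k)
  have "plus_span M N f k \<subseteq> plus_span M N f (Suc k)"
    using submoduleD(1)[OF assms(1)] by force
  with step show ?case by blast
qed simp

lemma plus_span_mono_base:
  assumes "M \<subseteq> M'" shows "plus_span M N f k \<subseteq> plus_span M' N f k"
  using assms by (induction k) fastforce+

lemma plus_span_base:
  assumes "submodule C N" shows "M \<subseteq> plus_span M N f k"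
  using plus_span_mono[OF assms, of 0 k M f] by simp

lemma plus_span_decompose:
  "p \<in> plus_span M N f k \<Longrightarrow> \<exists>q\<in>M. \<exists>l\<in>plus_span {0} N f k. p = q + l"
proof (induction k arbitrary: p)
  case (Suc k)
  then obtain q h where "p = q + f k * h" "q \<in> plus_span M N f k" "h \<in> N" by auto
  with Suc.IH[of q] obtain j l where "p = j + (l + f k * h)" "j \<in> M" "l \<in> plus_span {0} N f k"
    by (auto simp: add.assoc)
  with \<open>h \<in> N\<close> show ?case by (auto 0 4)
qed auto

lemma plus_span_generator:
  assumes "submodule C N" "submodule C M" "i < k" "h \<in> N"
  shows "f i * h \<in> plus_span M N f k"
proof -
  have "0 \<in> plus_span M N f i" using submodule_plus_span[OF assms(2,1)] submoduleD(1) by blast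
  then have "f i * h \<in> plus_span M N f (Suc i)" using assms(4) by force
  then show ?thesis using plus_span_mono[OF assms(1), of "Suc i" k] assms(3) by (meson Suc_leI subsetD)
qed

lemma plus_span_subset:
  assumes "submodule C C" "submodule C M" "M \<subseteq> C" "\<And>i. i < k \<Longrightarrow> f i \<in> C"
  shows "plus_span M C f k \<subseteq> C"
  using assms(4)
proof (induction k)
  case (Suc k)
  have "f k * h \<in> C" if "h \<in> C" for h using submoduleD(3)[OF assms(1)] Suc.prems that by simp
  with Suc show ?case using submoduleD(2)[OF assms(1)] by fastforce
qed (use assms in simp)

text \<open>Elementary form of the vanishing of \<open>Tor\<^sub>1(C/(f), C/M)\<close> for a sequence \<open>f\<close> regular on \<open>C/M\<close>.\<close>

lemma regular_plus_span_Int: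
  assumes C: "subring_set C" and M: "submodule C M" "M \<subseteq> C"
    and f: "\<And>i. i < k \<Longrightarrow> f i \<in> C"
    and reg: "\<And>i. i < k \<Longrightarrow> nonzerodivisor_mod C (plus_span M C f i) (f i)"
    and p: "p \<in> plus_span {0} C f k" "p \<in> M"
  shows "p \<in> plus_span {0} M f k"
  using f reg p
proof (induction k arbitrary: p)
  case (Suc k)
  have CC: "submodule C C" using C by (simp add: subring_set_def)
  have L: "submodule C (plus_span M C f k)" by (rule submodule_plus_span[OF M(1) CC])
  have L0: "submodule C (plus_span {0} C f k)" by (rule submodule_plus_span[OF submodule_zero CC])
  obtain q h where p: "p = q + f k * h" "q \<in> plus_span {0} C f k" "h \<in> C"
    using Suc.prems by auto
  have "q \<in> plus_span M C f k"
    using plus_span_mono_base[of "{0}" M C f k] submoduleD(1)[OF M(1)] p by auto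
  moreover have "p \<in> plus_span M C f k" using plus_span_base[OF CC] Suc.prems by blast
  \<comment> \<open>Both \<open>p\<close> and \<open>q\<close> lie in the span over
    \<open>M\<close>, hence so does their difference; regularity then applies to
    \<open>h\<close>.\<close>
  ultimately have "f k * h \<in> plus_span M C f k"
    using submodule_diff[OF C L, of p q] p by simp
  then have "h \<in> plus_span M C f k"
    using Suc.prems(2)[of k] p by (auto simp: nonzerodivisor_mod_def)
  then obtain j l where h: "h = j + l" "j \<in> M" "l \<in> plus_span {0} C f k"
    using plus_span_decompose by blast
  have fk: "f k \<in> C" using Suc.prems by simp
  \<comment> \<open>Splitting \<open>h = j + l\<close> and moving \<open>f k * l\<close> to
    \<open>q\<close> leaves \<open>f k * j\<close> with \<open>j \<in> M\<close>. The new first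
    summand lies in \<open>M\<close> and in the span of the first \<open>k\<close> elements, so the
    induction hypothesis applies to it.\<close>
  have "q + f k * l \<in> plus_span {0} C f k"
    using submoduleD[OF L0] fk h p by simp
  moreover have "q + f k * l = p - f k * j" using p h by (simp add: algebra_simps)
  then have "q + f k * l \<in> M"
    using submodule_diff[OF C M(1)] submoduleD(3)[OF M(1) fk h(2)] Suc.prems by simp
  ultimately have "q + f k * l \<in> plus_span {0} M f k" using Suc by simp
  moreover have "p = (q + f k * l) + f k * j" using p h by (simp add: algebra_simps)
  ultimately show ?case using h by auto
qed simp

text \<open>The hypothesis \<open>sep\<close> replaces Krull's intersection theorem for \<open>C/M\<close> and the ideal \<open>(g)\<close>.\<close>

lemma nonzerodivisor_mod_descend:
  assumes C: "subring_set C" and M: "submodule C M" and gC: "g \<in> C" and fC: "f \<in> C"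
    and g: "nonzerodivisor_mod C M g"
    and f: "nonzerodivisor_mod C {p + g * h | p h. p \<in> M \<and> h \<in> C} f"
    and sep: "\<And>h. h \<in> C \<Longrightarrow> (\<And>t. \<exists>m\<in>M. \<exists>s\<in>C. h = m + g ^ t * s) \<Longrightarrow> h \<in> M"
  shows "nonzerodivisor_mod C M f"
  unfolding nonzerodivisor_mod_def
proof (intro ballI impI)
  fix h assume h: "h \<in> C" "f * h \<in> M"
  have CC: "submodule C C" using C by (simp add: subring_set_def)
  have cancel: "f * s \<in> M" if "s \<in> C" "g ^ t * (f * s) \<in> M" for t s
    using that(2)
  proof (induction t)
    case (Suc t)
    have "g ^ t * (f * s) \<in> C" using submodule_power[OF C gC] submoduleD(3)[OF CC fC] that by simp
    moreover have "g * (g ^ t * (f * s)) \<in> M" using Suc.prems by (simp add: mult.assoc)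
    ultimately show ?case using g Suc.IH by (simp add: nonzerodivisor_mod_def)
  qed simp
  \<comment> \<open>If \<open>h = m + g ^ t * s\<close>, then cancelling \<open>g ^ t\<close> gives
    \<open>f * s \<in> M\<close>, and the hypothesis on \<open>f\<close> puts \<open>s\<close> into
    M + g C. This raises \<open>t\<close> by one.\<close>
  have "\<exists>m\<in>M. \<exists>s\<in>C. h = m + g ^ t * s" for t
  proof (induction t)
    case 0
    show ?case
      by (rule bexI[of _ 0], rule bexI[of _ h]) (use h submoduleD(1)[OF M] in auto)
  next
    case (Suc t)
    then obtain m s where ms: "m \<in> M" "s \<in> C" "h = m + g ^ t * s" by blast
    have "g ^ t * (f * s) = f * h - f * m" using ms by (simp add: algebra_simps)
    then have "g ^ t * (f * s) \<in> M"
      using submodule_diff[OF C M h(2) submoduleD(3)[OF M fC ms(1)]] by simp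
    then have "f * s \<in> M" by (rule cancel[OF ms(2)])
    moreover have "0 \<in> C" using submoduleD(1)[OF CC] .
    moreover have "f * s = f * s + g * 0" by simp
    ultimately have "f * s \<in> {p + g * h | p h. p \<in> M \<and> h \<in> C}" by blast
    then obtain m' s' where s: "s = m' + g * s'" "m' \<in> M" "s' \<in> C"
      using f ms(2) by (auto simp: nonzerodivisor_mod_def)
    have "h = (m + g ^ t * m') + g ^ Suc t * s'" using ms s by (simp add: algebra_simps)
    moreover have "m + g ^ t * m' \<in> M"
    proof -
      have "g ^ t \<in> C" using submodule_power[OF C gC, of 1 t] C by (simp add: subring_set_def)
      then show ?thesis using submoduleD[OF M] ms s by simp
    qed
    ultimately show ?case using s by blast
  qed
  with sep h show "h \<in> M" by blast
qed

section \<open>Renaming of variables\<close>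

abbreviation "keys \<equiv> Poly_Mapping.keys"
abbreviation "lookup \<equiv> Poly_Mapping.lookup"
abbreviation "single \<equiv> Poly_Mapping.single"

lemma poly_mapping_single_induct:
  assumes "P 0" "\<And>m a p. P p \<Longrightarrow> P (single m a + p)"
  shows "P (p :: 'a \<Rightarrow>\<^sub>0 'b::monoid_add)"
proof (induction p rule: update_induct)
  case (update p m a)
  have "Poly_Mapping.update m a p = single m a + p"
    using update by (intro poly_mapping_eqI) (auto simp: lookup_update lookup_add lookup_single in_keys_iff)
  then show ?case using assms update by simp
qed (use assms in simp)

lemma keys_add_nat: "keys (a + b :: 'v \<Rightarrow>\<^sub>0 nat) = keys a \<union> keys b"
  by (auto simp: in_keys_iff lookup_add)

definition rename_exp :: "('v \<Rightarrow> 'w) \<Rightarrow> ('v \<Rightarrow>\<^sub>0 nat) \<Rightarrow> ('w \<Rightarrow>\<^sub>0 nat)" where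
  "rename_exp g m = (\<Sum>v\<in>keys m. single (g v) (lookup m v))"

lemma rename_exp_superset:
  assumes "finite A" "keys m \<subseteq> A"
  shows "rename_exp g m = (\<Sum>v\<in>A. single (g v) (lookup m v))"
  unfolding rename_exp_def using assms
  by (intro sum.mono_neutral_left) (auto simp: in_keys_iff)

lemma rename_exp_add: "rename_exp g (a + b) = rename_exp g a + rename_exp g b"
proof -
  let ?A = "keys a \<union> keys b"
  have "rename_exp g (a + b) = (\<Sum>v\<in>?A. single (g v) (lookup (a + b) v))"
    by (rule rename_exp_superset) (auto simp: keys_add_nat)
  also have "\<dots> = (\<Sum>v\<in>?A. single (g v) (lookup a v)) + (\<Sum>v\<in>?A. single (g v) (lookup b v))"
    by (simp add: lookup_add single_add sum.distrib)
  also have "\<dots> = rename_exp g a + rename_exp g b"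
    by (simp add: rename_exp_superset[of ?A a] rename_exp_superset[of ?A b])
  finally show ?thesis .
qed

lemma rename_exp_single [simp]: "rename_exp g (single v k) = single (g v) k"
  by (simp add: rename_exp_def)

lemma rename_exp_0 [simp]: "rename_exp g 0 = 0"
  by (simp add: rename_exp_def)

lemma rename_exp_sum: "rename_exp g (sum h A) = (\<Sum>x\<in>A. rename_exp g (h x))"
  by (induction A rule: infinite_finite_induct) (auto simp: rename_exp_add)

lemma rename_exp_ident:
  assumes "\<And>v. v \<in> keys m \<Longrightarrow> g v = v"
  shows "rename_exp g m = m"
proof (rule poly_mapping_eqI)
  fix k
  have "lookup (rename_exp g m) k = (\<Sum>v\<in>keys m. lookup m v when v = k)"
    using assms by (simp add: rename_exp_def lookup_sum lookup_single)
  also have "\<dots> = lookup m k" by (auto simp: when_def in_keys_iff)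
  finally show "lookup (rename_exp g m) k = lookup m k" .
qed

lemma rename_exp_comp: "rename_exp h (rename_exp g m) = rename_exp (h \<circ> g) m"
  by (simp add: rename_exp_def[of g] rename_exp_def[of "h \<circ> g"] rename_exp_sum)

lemma keys_rename_exp: "keys (rename_exp g m) = g ` keys m"
proof (induction m rule: poly_mapping_single_induct)
  case (2 m a p)
  then show ?case by (simp add: rename_exp_add keys_add_nat image_Un)
qed simp

text \<open>Two variables of \<open>m\<close> with the same image would give that image an exponent
  of at least 2.\<close>

lemma lookup_rename_exp_inj:
  assumes "\<And>w. lookup (rename_exp g m) w \<le> 1"
  shows "inj_on g (keys m)"
proof (rule inj_onI, rule ccontr)
  fix u v assume uv: "u \<in> keys m" "v \<in> keys m" "g u = g v" "u \<noteq> v"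
  define e where "e = m - single u 1 - single v 1"
  have "m = single u 1 + (single v 1 + e)"
  proof (rule poly_mapping_eqI)
    fix k show "lookup m k = lookup (single u 1 + (single v 1 + e)) k"
      using uv by (auto simp: e_def lookup_add lookup_minus lookup_single in_keys_iff when_def)
  qed
  then have "rename_exp g m = single (g u) 1 + (single (g u) 1 + rename_exp g e)"
    using uv by (metis rename_exp_add rename_exp_single)
  then have "lookup (rename_exp g m) (g u) \<ge> 2"
    by (simp add: lookup_add)
  with assms[of "g u"] show False by simp
qed

text \<open>Substituting variables for variables sends monomials to monomials, so computations
  reduce to \<open>rename_exp\<close> on exponents.\<close>

definition rename :: "('v \<Rightarrow> 'w) \<Rightarrow> ('v, 'k::field) mpoly \<Rightarrow> ('w, 'k) mpoly" where
  "rename g = psubst (\<lambda>v. pvar (g v))"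

lemma single_prod_power:
  "(\<Prod>v\<in>A. pvar (g v) ^ e v) = single (\<Sum>v\<in>A. single (g v) (e v)) (1::'k::field)"
proof -
  have power: "pvar u ^ k = single (single u k) (1::'k)" for u :: 'c and k
    by (induction k) (auto simp: pvar_def mult_single simp flip: single_add)
  show ?thesis
    by (induction A rule: infinite_finite_induct) (auto simp: mult_single power)
qed

lemma rename_eq: "rename g p = (\<Sum>m\<in>keys p. single (rename_exp g m) (lookup p m))"
  by (simp add: rename_def psubst_def single_prod_power mult_single rename_exp_def)

lemma rename_add: "rename g (p + q) = rename g p + rename g q"
  unfolding rename_eq by (rule setsum_keys_plus_distrib) (auto simp: single_add)

lemma rename_single [simp]: "rename g (single m a) = single (rename_exp g m) a"
  by (simp add: rename_eq)

lemma rename_0 [simp]: "rename g 0 = 0"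
  by (simp add: rename_eq)

lemma rename_uminus: "rename g (- p) = - rename g p"
  using rename_add[of g p "- p"] by (simp add: eq_neg_iff_add_eq_0 add.commute)

lemma rename_diff: "rename g (p - q) = rename g p - rename g q"
  using rename_add[of g p "- q"] by (simp add: rename_uminus)

lemma rename_mult: "rename g (p * q) = rename g p * rename g q"
proof (induction p rule: poly_mapping_single_induct)
  case (2 m a p)
  have "rename g (single m a * q) = single (rename_exp g m) a * rename g q"
    by (induction q rule: poly_mapping_single_induct)
      (auto simp: distrib_left rename_add mult_single rename_exp_add)
  with 2 show ?case by (simp add: distrib_right rename_add)
qed simp

lemma rename_pvar [simp]: "rename g (pvar v) = pvar (g v)"
  by (simp add: pvar_def)

lemma keys_rename: "keys (rename g p) \<subseteq> rename_exp g ` keys p"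
  unfolding rename_eq
  by (rule subsetI, drule subsetD[OF keys_sum]) (auto split: if_splits)

section \<open>Coefficients and truncation\<close>

lemma single_add_diff:
  assumes "v \<in> keys m" shows "single v 1 + (m - single v 1) = (m :: 'v \<Rightarrow>\<^sub>0 nat)"
proof (rule poly_mapping_eqI)
  fix k show "lookup (single v 1 + (m - single v 1)) k = lookup m k"
    using assms by (auto simp: lookup_add lookup_minus lookup_single in_keys_iff when_def)
qed

lemma lookup_pvar_mult:
  "lookup (pvar v * p) m = (if v \<in> keys m then lookup p (m - single v 1) else 0)"
proof (induction p rule: poly_mapping_single_induct)
  case (2 l a p)
  have "lookup (pvar v * single l a) m = (a when single v 1 + l = m)"
    by (simp add: pvar_def mult_single lookup_single)
  also have "single v 1 + l = m \<longleftrightarrow> v \<in> keys m \<and> l = m - single v 1"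
    using single_add_diff[of v m] by (auto simp: keys_add_nat)
  finally show ?case using 2 by (simp add: distrib_left lookup_add lookup_single when_def)
qed simp

text \<open>The total degree: renaming all variables to the one element of \<open>unit\<close> adds
  up the exponents.\<close>

definition exp_degree :: "('v \<Rightarrow>\<^sub>0 nat) \<Rightarrow> nat" where
  "exp_degree m = lookup (rename_exp (\<lambda>_. ()) m) ()"

lemma exp_degree_single_add: "exp_degree (single v 1 + m) = Suc (exp_degree m)"
  by (simp add: exp_degree_def rename_exp_add lookup_add)

text \<open>Closure of an ideal under truncation expresses that the ideal is graded.\<close>

definition truncate :: "nat \<Rightarrow> ('v, 'k::field) mpoly \<Rightarrow> ('v, 'k) mpoly" where
  "truncate d p = (\<Sum>m\<in>{m \<in> keys p. exp_degree m < d}. single m (lookup p m))"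

lemma lookup_truncate: "lookup (truncate d p) m = (lookup p m when exp_degree m < d)"
proof -
  have "lookup (truncate d p) m =
      (\<Sum>l\<in>{m \<in> keys p. exp_degree m < d}. if l = m then lookup p l else 0)"
    by (simp add: truncate_def lookup_sum lookup_single when_def)
  then show ?thesis by (auto simp: when_def in_keys_iff)
qed

lemma keys_truncate: "keys (truncate d p) \<subseteq> keys p"
  by (auto simp: in_keys_iff lookup_truncate)

lemma truncate_add: "truncate d (p + q) = truncate d p + truncate d q"
  by (rule poly_mapping_eqI) (simp add: lookup_truncate lookup_add when_def)

lemma truncate_diff: "truncate d (p - q) = truncate d p - truncate d q"
  by (rule poly_mapping_eqI) (simp add: lookup_truncate lookup_minus when_def)

lemma truncate_0 [simp]: "truncate 0 p = 0"
  by (rule poly_mapping_eqI) (simp add: lookup_truncate)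

lemma truncate_pvar_mult: "truncate (Suc d) (pvar v * p) = pvar v * truncate d p"
proof (rule poly_mapping_eqI)
  fix m
  have "exp_degree m = Suc (exp_degree (m - single v 1))" if "v \<in> keys m"
    using exp_degree_single_add[of v "m - single v 1"] single_add_diff[OF that] by simp
  then show "lookup (truncate (Suc d) (pvar v * p)) m = lookup (pvar v * truncate d p) m"
    by (auto simp: lookup_truncate lookup_pvar_mult when_def)
qed

text \<open>A difference of two variables is homogeneous of degree 1, so multiplication by it shifts
  the truncation by one.\<close>

lemma truncate_diff_mult:
  "truncate (Suc d) ((pvar u - pvar v) * p) = (pvar u - pvar v) * truncate d p"
  by (simp add: left_diff_distrib truncate_diff truncate_pvar_mult)

lemma truncate_diff_power_mult: "truncate d ((pvar u - pvar v) ^ d * p) = 0"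
  by (induction d) (auto simp: mult.assoc truncate_diff_mult)

lemma truncate_eq_self: "\<exists>d. truncate d p = p"
proof -
  define d where "d = Suc (Max (insert 0 (exp_degree ` keys p)))"
  have "exp_degree m < d" if "m \<in> keys p" for m
    unfolding d_def less_Suc_eq_le using that by (intro Max_ge) auto
  then have "truncate d p = p"
    by (intro poly_mapping_eqI) (auto simp: lookup_truncate when_def in_keys_iff)
  then show ?thesis ..
qed

section \<open>Monomial ideals determined by supports\<close>

text \<open>For upsets \<open>U\<close> these are the square-free monomial ideals, see
  \<open>sqfree_monomial_ideal_iff\<close>, so ideals can be replaced by families of sets.
  \<open>Pow V\<close> gives the whole ring, the empty family the zero ideal.\<close>

definition supp_ideal :: "'v set set \<Rightarrow> ('v, 'k::field) mpoly set" where
  "supp_ideal U = {p. \<forall>m\<in>keys p. keys m \<in> U}"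

abbreviation polys :: "'v set \<Rightarrow> ('v, 'k::field) mpoly set" where
  "polys V \<equiv> supp_ideal (Pow V)"

definition upset :: "'v set \<Rightarrow> 'v set set \<Rightarrow> bool" where
  "upset V U \<longleftrightarrow> U \<subseteq> Pow V \<and> (\<forall>\<sigma>\<in>U. \<forall>\<tau>. \<sigma> \<subseteq> \<tau> \<longrightarrow> \<tau> \<subseteq> V \<longrightarrow> \<tau> \<in> U)"

definition ind :: "'v set \<Rightarrow> 'v \<Rightarrow>\<^sub>0 nat" where
  "ind \<sigma> = (\<Sum>v\<in>\<sigma>. single v 1)"

lemma upset_Pow: "upset V (Pow V)"
  by (auto simp: upset_def)

lemma upsetD:
  assumes "upset V U" "\<sigma> \<in> U"
  shows "\<sigma> \<subseteq> V" "\<And>\<tau>. \<sigma> \<subseteq> \<tau> \<Longrightarrow> \<tau> \<subseteq> V \<Longrightarrow> \<tau> \<in> U"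
  using assms by (auto simp: upset_def)

lemma supp_ideal_mono: "U \<subseteq> U' \<Longrightarrow> supp_ideal U \<subseteq> supp_ideal U'"
  by (auto simp: supp_ideal_def)

lemma supp_ideal_add: "p \<in> supp_ideal U \<Longrightarrow> q \<in> supp_ideal U \<Longrightarrow> p + q \<in> supp_ideal U"
  using Poly_Mapping.keys_add[of p q] by (auto simp: supp_ideal_def)

lemma supp_ideal_mult:
  assumes "upset V U" "q \<in> polys V" "p \<in> supp_ideal U"
  shows "q * p \<in> supp_ideal U"
  unfolding supp_ideal_def
proof (intro CollectI ballI)
  fix m assume "m \<in> keys (q * p)"
  then obtain a b where "m = a + b" "a \<in> keys q" "b \<in> keys p" using keys_mult[of q p] by blast
  then show "keys m \<in> U"
    using assms upsetD[OF assms(1), of "keys b"] by (auto simp: supp_ideal_def keys_add_nat)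
qed

lemma submodule_supp_ideal: "upset V U \<Longrightarrow> submodule (polys V) (supp_ideal U)"
  by (simp add: submodule_def supp_ideal_mult supp_ideal_add) (simp add: supp_ideal_def)

lemma subring_polys: "subring_set (polys V)"
  unfolding subring_set_def using submodule_supp_ideal[OF upset_Pow]
  by (auto simp: supp_ideal_def in_keys_iff lookup_one)

lemma submodule_polys: "submodule (polys V) (polys V)"
  by (rule submodule_supp_ideal[OF upset_Pow])

lemma supp_ideal_subset_polys: "upset V U \<Longrightarrow> supp_ideal U \<subseteq> polys V"
  by (rule supp_ideal_mono) (simp add: upset_def)

lemma supp_ideal_truncate: "p \<in> supp_ideal U \<Longrightarrow> truncate d p \<in> supp_ideal U"
  using keys_truncate[of d p] by (auto simp: supp_ideal_def)

lemma single_in_supp_ideal: "keys m \<in> U \<Longrightarrow> single m a \<in> supp_ideal U"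
  by (simp add: supp_ideal_def)

lemma pvar_in_polys: "v \<in> V \<Longrightarrow> pvar v \<in> polys V"
  by (simp add: pvar_def supp_ideal_def)

lemma poly_mapping_sum_monomials: "p = (\<Sum>m\<in>keys p. single m (lookup p m))"
proof (rule poly_mapping_eqI)
  fix k
  have "lookup (\<Sum>m\<in>keys p. single m (lookup p m)) k = (\<Sum>m\<in>keys p. if m = k then lookup p m else 0)"
    by (simp add: lookup_sum lookup_single when_def)
  then show "lookup p k = lookup (\<Sum>m\<in>keys p. single m (lookup p m)) k"
    by (auto simp: in_keys_iff)
qed

lemma submodule_sum:
  assumes "submodule C M" "\<And>x. x \<in> A \<Longrightarrow> h x \<in> M"
  shows "sum h A \<in> M"
  using assms(2) by (induction A rule: infinite_finite_induct) (auto simp: submoduleD[OF assms(1)])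

lemma submodule_monomials:
  assumes "submodule C M" "\<And>m. m \<in> keys p \<Longrightarrow> single m (lookup p m) \<in> M"
  shows "p \<in> M"
  by (subst poly_mapping_sum_monomials[of p]) (rule submodule_sum[OF assms])

lemma keys_ind: "finite \<sigma> \<Longrightarrow> keys (ind \<sigma>) = \<sigma>"
  unfolding ind_def by (rule keys_sum_single)

lemma lookup_ind: "finite \<sigma> \<Longrightarrow> lookup (ind \<sigma>) v = (if v \<in> \<sigma> then 1 else 0)"
  by (simp add: ind_def lookup_sum lookup_single when_def)

lemma ind_add_diff:
  assumes "\<sigma> \<subseteq> keys m" shows "ind \<sigma> + (m - ind \<sigma>) = m"
proof (rule poly_mapping_eqI)
  fix k
  have "finite \<sigma>" using assms by (rule finite_subset) simp
  then show "lookup (ind \<sigma> + (m - ind \<sigma>)) k = lookup m k"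
    using assms by (auto simp: lookup_add lookup_minus lookup_ind in_keys_iff)
qed

lemma ind_subset: "finite \<tau> \<Longrightarrow> \<sigma> \<subseteq> \<tau> \<Longrightarrow> ind \<tau> = ind \<sigma> + ind (\<tau> - \<sigma>)"
  unfolding ind_def by (simp add: sum.subset_diff add.commute)

lemma rename_exp_ind: "inj_on g \<sigma> \<Longrightarrow> rename_exp g (ind \<sigma>) = ind (g ` \<sigma>)"
  by (simp add: ind_def rename_exp_sum sum.reindex)

lemma rename_in_polys:
  assumes "p \<in> polys V" "g ` V \<subseteq> W" shows "rename g p \<in> polys W"
  using assms keys_rename[of g p] by (fastforce simp: supp_ideal_def keys_rename_exp)

text \<open>A monomial of \<open>q\<close> supported in \<open>N\<close> with maximal \<open>x\<close>-exponent survives in \<open>(x - y) q\<close>.\<close>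

lemma diff_pvar_mult_support:
  assumes "x \<noteq> y" "m0 \<in> keys q" "keys m0 \<subseteq> N" "x \<in> N"
  shows "\<exists>m\<in>keys ((pvar x - pvar y) * q). keys m \<subseteq> N"
proof -
  define S where "S = {m \<in> keys q. keys m \<subseteq> N}"
  have "finite S" "S \<noteq> {}" using assms by (auto simp: S_def)
  then obtain m where m: "m \<in> S" "\<And>l. l \<in> S \<Longrightarrow> lookup l x \<le> lookup m x"
    using Max_in[of "(\<lambda>m. lookup m x) ` S"] Max_ge[of "(\<lambda>m. lookup m x) ` S"] by fastforce
  define n where "n = single x 1 + m"
  have n: "keys n \<subseteq> N" using m assms by (auto simp: n_def S_def keys_add_nat)
  \<comment> \<open>This exponent would be supported in \<open>N\<close> with an
    \<open>x\<close>-exponent one above that of \<open>m\<close>, against maximality. Hence nothing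
    cancels the coefficient of \<open>m\<close> after the shift by \<open>x\<close>.\<close>
  have "lookup q (n - single y 1) = 0"
  proof (rule ccontr)
    assume "lookup q (n - single y 1) \<noteq> 0"
    moreover have "keys (n - single y 1) \<subseteq> keys n" by (auto simp: in_keys_iff lookup_minus)
    ultimately have "n - single y 1 \<in> S" using n by (auto simp: S_def in_keys_iff)
    from m(2)[OF this] show False
      using assms(1) by (simp add: n_def lookup_minus lookup_add lookup_single when_def)
  qed
  then have "lookup ((pvar x - pvar y) * q) n = lookup q m"
    by (simp add: left_diff_distrib lookup_minus lookup_pvar_mult) (simp add: n_def keys_add_nat)
  with m(1) n show ?thesis by (auto simp: S_def in_keys_iff intro!: bexI[of _ n])
qed

text \<open>The condition \<open>ex\<close> says that no minimal vertex cover contains both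
  \<open>x\<close> and \<open>y\<close>. If \<open>q\<close> has a monomial with support M outside
  \<open>U\<close>, then \<open>diff_pvar_mult_support\<close> for N = \<open>insert x M\<close>,
  and symmetrically for \<open>y\<close>, puts both enlarged sets into \<open>U\<close>.\<close>

lemma nonzerodivisor_mod_supp_ideal:
  assumes U: "upset V U" and xy: "x \<in> V" "y \<in> V" "x \<noteq> y"
    and ex: "\<And>M. M \<subseteq> V \<Longrightarrow> M \<notin> U \<Longrightarrow> insert x M \<notin> U \<or> insert y M \<notin> U"
  shows "nonzerodivisor_mod (polys V) (supp_ideal U) (pvar x - pvar y :: ('v, 'k::field) mpoly)"
  unfolding nonzerodivisor_mod_def
proof (intro ballI impI)
  fix q :: "('v, 'k) mpoly"
  assume q: "q \<in> polys V" "(pvar x - pvar y) * q \<in> supp_ideal U"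
  have "- ((pvar x - pvar y) * q) \<in> supp_ideal U"
    by (rule submodule_uminus[OF subring_polys submodule_supp_ideal[OF U] q(2)])
  then have q': "(pvar y - pvar x) * q \<in> supp_ideal U" by (simp add: algebra_simps)
  show "q \<in> supp_ideal U"
  proof (rule ccontr)
    assume "q \<notin> supp_ideal U"
    then obtain m where m: "m \<in> keys q" "keys m \<notin> U" by (auto simp: supp_ideal_def)
    have mV: "keys m \<subseteq> V" using q m by (auto simp: supp_ideal_def)
    have *: "insert z (keys m) \<in> U"
      if z: "z \<in> V" "z \<noteq> z'" "(pvar z - pvar z') * q \<in> supp_ideal U" for z z'
    proof -
      obtain n where "n \<in> keys ((pvar z - pvar z') * q)" "keys n \<subseteq> insert z (keys m)"
        using diff_pvar_mult_support[OF z(2) m(1), of "insert z (keys m)"] by blast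
      then show ?thesis using z mV upsetD(2)[OF U, of "keys n" "insert z (keys m)"]
        by (auto simp: supp_ideal_def)
    qed
    from ex[OF mV m(2)] *[OF xy(1,3) q(2)] *[OF xy(2) xy(3)[symmetric] q'] show False by blast
  qed
qed

section \<open>Regularity in terms of supports\<close>

text \<open>\<open>c\<close> sends every variable to the representative of its fibre, and \<open>ys\<close> lists the variables
  that get identified with their representative.\<close>

locale merging =
  fixes V :: "'v set" and c :: "'v \<Rightarrow> 'v" and ys :: "'v list"
  assumes fin: "finite V"
    and cV: "v \<in> V \<Longrightarrow> c v \<in> V"
    and cc: "v \<in> V \<Longrightarrow> c (c v) = c v"
    and distinct: "distinct ys"
    and set_ys: "set ys = {v \<in> V. c v \<noteq> v}"
begin

definition step :: "nat \<Rightarrow> ('v, 'k::field) mpoly" where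
  "step k = pvar (c (ys ! k)) - pvar (ys ! k)"

text \<open>Despite its name an ideal: the one modulo which \<open>step k\<close> has to be a
  nonzerodivisor.\<close>

abbreviation quot :: "'v set set \<Rightarrow> nat \<Rightarrow> ('v, 'k::field) mpoly set" where
  "quot U \<equiv> plus_span (supp_ideal U) (polys V) step"

abbreviation steps :: "nat \<Rightarrow> ('v, 'k::field) mpoly set" where
  "steps \<equiv> plus_span {0} (polys V) step"

text \<open>The field occurs only in the type of the polynomials, so it is passed through
  \<open>itself\<close>.\<close>

definition regular :: "'k::field itself \<Rightarrow> 'v set set \<Rightarrow> bool" where
  "regular _ U \<longleftrightarrow> (\<forall>k<length ys.
     nonzerodivisor_mod (polys V) (quot U k) (step k :: ('v, 'k) mpoly))"

text \<open>For families of subsets of the finite \<open>V\<close> this says that \<open>c\<close>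
  is injective on all minimal members, which are the supports of the minimal generators.\<close>

definition inj_below :: "'v set set \<Rightarrow> bool" where
  "inj_below U \<longleftrightarrow> (\<forall>\<sigma>\<in>U. \<exists>\<sigma>'\<in>U. \<sigma>' \<subseteq> \<sigma> \<and> inj_on c \<sigma>')"

text \<open>The complements of the maximal non-members are the minimal vertex covers; the condition
  says that each of them contains at most one variable of every fibre.\<close>

definition coinj_above :: "'v set set \<Rightarrow> bool" where
  "coinj_above U \<longleftrightarrow> (\<forall>N\<subseteq>V. N \<notin> U \<longrightarrow> (\<exists>N'\<subseteq>V. N \<subseteq> N' \<and> N' \<notin> U \<and> inj_on c (V - N')))"

definition merge :: "nat \<Rightarrow> 'v \<Rightarrow> 'v" where
  "merge k v = (if v \<in> set (take k ys) then c v else v)"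

text \<open>The family for the ideal after identification. Identified variables stay in
  \<open>V\<close> with empty preimage, so all stages live in the same ring.\<close>

definition merged :: "nat \<Rightarrow> 'v set set \<Rightarrow> 'v set set" where
  "merged k U = {M. M \<subseteq> V \<and> {v \<in> V. merge k v \<in> M} \<in> U}"

lemma nth_ys: assumes "k < length ys" shows "ys ! k \<in> V" "c (ys ! k) \<noteq> ys ! k"
  using nth_mem[OF assms] set_ys by auto

lemma set_take: "set (take k ys) \<subseteq> {v \<in> V. c v \<noteq> v}"
  using set_take_subset[of k ys] set_ys by auto

lemma merge_V: "v \<in> V \<Longrightarrow> merge k v \<in> V"
  by (simp add: merge_def cV)

lemma c_merge: "v \<in> V \<Longrightarrow> c (merge k v) = c v"
  by (simp add: merge_def cc)

lemma merge_c: "v \<in> V \<Longrightarrow> merge k (c v) = c v"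
  using set_take[of k] by (auto simp: merge_def cc)

lemma merge_all: "v \<in> V \<Longrightarrow> merge (length ys) v = c v"
  by (simp add: merge_def set_ys)

lemma merge_nth: "i < k \<Longrightarrow> k \<le> length ys \<Longrightarrow> merge k (ys ! i) = c (ys ! i)"
  by (auto simp: merge_def in_set_conv_nth)

lemma merge_nth_self: "k < length ys \<Longrightarrow> merge k (ys ! k) = ys ! k"
  using distinct by (auto simp: merge_def in_set_conv_nth nth_eq_iff_index_eq)

lemma step_in_polys: "k < length ys \<Longrightarrow> step k \<in> polys V"
  unfolding step_def
  by (intro submodule_diff[OF subring_polys submodule_polys] pvar_in_polys cV nth_ys)

lemma submodule_quot: "upset V U \<Longrightarrow> submodule (polys V) (quot U k)"
  by (intro submodule_plus_span submodule_supp_ideal submodule_polys)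

lemma submodule_steps: "submodule (polys V) (steps k)"
  by (intro submodule_plus_span submodule_zero submodule_polys)

section \<open>The kernel of the identification of variables\<close>

lemma rename_step_zero:
  assumes "i < k" "k \<le> length ys" shows "rename (merge k) (step i) = 0"
  using assms merge_nth[OF assms] merge_c[of "ys ! i" k] nth_ys[of i]
  by (simp add: step_def rename_diff)

lemma rename_step_self: "k < length ys \<Longrightarrow> rename (merge k) (step k) = step k"
  using merge_nth_self[of k] merge_c[of "ys ! k" k] nth_ys[of k]
  by (simp add: step_def rename_diff)

lemma rename_steps:
  assumes "k \<le> length ys" "i \<le> k" "l \<in> steps i"
  shows "rename (merge k) l = 0"
  using assms(2,3)
proof (induction i arbitrary: l)
  case (Suc i)
  then show ?case using assms(1) by (auto simp: rename_add rename_mult rename_step_zero)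
qed simp

lemma pvar_diff_merge:
  assumes "k \<le> length ys" "v \<in> V"
  shows "pvar v - pvar (merge k v) \<in> steps k"
proof (cases "v \<in> set (take k ys)")
  case True
  then obtain i where i: "i < k" "v = ys ! i" using assms(1) by (auto simp: in_set_conv_nth)
  have "step i * (- 1) \<in> steps k"
    using subring_polys[of V] i
    by (intro plus_span_generator[OF submodule_polys submodule_zero]) (auto simp: subring_set_def)
  then show ?thesis using True i by (simp add: merge_def step_def)
next
  case False
  then show ?thesis using submoduleD(1)[OF submodule_steps] by (simp add: merge_def)
qed

text \<open>One factor is replaced at a time: v a - v' b = v (a - b) + b (v - v'), where both
  differences lie in \<open>steps k\<close>.\<close>

lemma single_diff_rename_exp:
  assumes "k \<le> length ys" "keys m \<subseteq> V"
  shows "single m (1::'k::field) - single (rename_exp (merge k) m) 1 \<in> steps k"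
  using assms(2)
proof (induction m rule: poly_mapping_single_induct)
  case 1
  then show ?case using submoduleD(1)[OF submodule_steps] by simp
next
  case (2 v n m)
  note S = submoduleD[OF submodule_steps[of k]]
  have V: "v \<in> V" if "n \<noteq> 0" and m: "keys m \<subseteq> V"
    using 2 that by (auto simp: keys_add_nat)
  have "single (single v n + m) (1::'k) - single (rename_exp (merge k) (single v n + m)) 1 \<in> steps k"
    if "keys (single v n + m) \<subseteq> V" for n
    using that
  proof (induction n)
    case 0
    then show ?case using 2 by simp
  next
    case (Suc n)
    let ?a = "single (single v n + m) (1::'k)"
    let ?b = "single (rename_exp (merge k) (single v n + m)) (1::'k)"
    have v: "v \<in> V" and sub: "keys (single v n + m) \<subseteq> V"
      using Suc.prems by (auto simp: keys_add_nat split: if_splits)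
    have ab: "?a - ?b \<in> steps k" by (rule Suc.IH[OF sub])
    have b: "?b \<in> polys V"
      using sub merge_V by (intro single_in_supp_ideal) (auto simp: keys_rename_exp)
    have eq: "single (single v (Suc n) + m) 1 = pvar v * ?a"
      "single (rename_exp (merge k) (single v (Suc n) + m)) 1 = pvar (merge k v) * ?b"
      by (simp_all add: pvar_def mult_single rename_exp_add add.assoc flip: single_add)
        (simp_all add: add.assoc[symmetric] flip: single_add)
    have "single (single v (Suc n) + m) 1 - single (rename_exp (merge k) (single v (Suc n) + m)) 1 =
        pvar v * (?a - ?b) + ?b * (pvar v - pvar (merge k v))"
      unfolding eq by (simp add: algebra_simps)
    also have "\<dots> \<in> steps k"
      by (intro S(2,3) ab b pvar_in_polys[OF v] pvar_diff_merge[OF assms(1) v])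
    finally show ?case .
  qed
  from this[OF 2(2)] show ?case .
qed

text \<open>Together with \<open>rename_steps\<close> this identifies \<open>steps k\<close> as the
  kernel of \<open>rename (merge k)\<close> on \<open>polys V\<close>.\<close>

lemma diff_rename_in_steps:
  assumes "k \<le> length ys" "p \<in> polys V"
  shows "p - rename (merge k) p \<in> steps k"
proof -
  have "single m (lookup p m) - single (rename_exp (merge k) m) (lookup p m) \<in> steps k"
    if "m \<in> keys p" for m
  proof -
    have "single 0 (lookup p m) * (single m 1 - single (rename_exp (merge k) m) 1) \<in> steps k"
      using assms that
      by (intro submoduleD(3)[OF submodule_steps] single_diff_rename_exp single_in_supp_ideal)
        (auto simp: supp_ideal_def)
    then show ?thesis by (simp add: right_diff_distrib mult_single)
  qed
  then have "(\<Sum>m\<in>keys p. single m (lookup p m) - single (rename_exp (merge k) m) (lookup p m)) \<in> steps k"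
    by (rule submodule_sum[OF submodule_steps])
  then show ?thesis
    by (simp add: sum_subtractf rename_eq poly_mapping_sum_monomials[symmetric])
qed

section \<open>Sufficiency of the condition on generators and covers\<close>

lemma upset_merged:
  assumes U: "upset V U" shows "upset V (merged k U)"
  unfolding upset_def
proof (intro conjI ballI allI impI)
  fix \<sigma> \<tau> assume \<sigma>: "\<sigma> \<in> merged k U" "\<sigma> \<subseteq> \<tau>" "\<tau> \<subseteq> V"
  have "{v \<in> V. merge k v \<in> \<tau>} \<in> U"
    by (rule upsetD(2)[OF U, of "{v \<in> V. merge k v \<in> \<sigma>}"]) (use \<sigma> in \<open>auto simp: merged_def\<close>)
  with \<sigma> show "\<tau> \<in> merged k U" by (simp add: merged_def)
qed (auto simp: merged_def)

lemma steps_subset_quot: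
  assumes "upset V U" shows "steps k \<subseteq> quot U k"
  by (rule plus_span_mono_base) (use submoduleD(1)[OF submodule_supp_ideal[OF assms]] in auto)

lemma rename_supp_ideal_merged:
  assumes U: "upset V U" and p: "p \<in> supp_ideal U"
  shows "rename (merge k) p \<in> supp_ideal (merged k U)"
proof -
  have "merge k ` keys m \<in> merged k U" if m: "m \<in> keys p" for m
  proof -
    have k: "keys m \<in> U" using p m by (auto simp: supp_ideal_def)
    have "{v \<in> V. merge k v \<in> merge k ` keys m} \<in> U"
      by (rule upsetD(2)[OF U k]) (use upsetD(1)[OF U k] in auto)
    then show ?thesis using upsetD(1)[OF U k] merge_V by (auto simp: merged_def)
  qed
  then show ?thesis using keys_rename[of "merge k" p]
    by (auto simp: supp_ideal_def keys_rename_exp dest!: subsetD)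
qed

text \<open>Computing modulo the first \<open>k\<close> differences amounts to computing modulo the
  merged ideal. For the converse direction \<open>inj_below\<close> lifts each monomial of the
  merged ideal to a multiple of the image of a square-free monomial of the original ideal.\<close>

lemma quot_iff:
  assumes U: "upset V U" "inj_below U" and k: "k \<le> length ys" and p: "p \<in> polys V"
  shows "p \<in> quot U k \<longleftrightarrow> rename (merge k) (p :: ('v, 'k::field) mpoly) \<in> supp_ideal (merged k U)"
proof
  assume "p \<in> quot U k"
  then obtain q l where "p = q + l" "q \<in> supp_ideal U" "l \<in> steps k"
    using plus_span_decompose by blast
  then show "rename (merge k) p \<in> supp_ideal (merged k U)"
    using rename_supp_ideal_merged[OF U(1), of q k] rename_steps[OF k order.refl, of l]
    by (simp add: rename_add)
next
  note Q = submoduleD[OF submodule_quot[OF U(1), of k]]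
  assume r: "rename (merge k) p \<in> supp_ideal (merged k U)"
  have mono: "single m a \<in> quot U k" if m: "keys m \<in> merged k U" for m and a :: 'k
  proof -
    obtain \<sigma> where \<sigma>: "\<sigma> \<in> U" "\<sigma> \<subseteq> {v \<in> V. merge k v \<in> keys m}" "inj_on c \<sigma>"
      using m U(2) unfolding merged_def inj_below_def by blast
    have "\<sigma> \<subseteq> V" using \<sigma>(2) by blast
    then have f\<sigma>: "finite \<sigma>" using fin by (rule finite_subset)
    \<comment> \<open>\<open>c\<close> factors through \<open>merge k\<close>. Thus the image of the
      monomial of \<sigma> is square-free, and it divides \<open>m\<close> with cofactor
      \<open>?e\<close>.\<close>
    have inj: "inj_on (merge k) \<sigma>"
    proof (rule inj_onI)
      fix u v assume "u \<in> \<sigma>" "v \<in> \<sigma>" "merge k u = merge k v"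
      then have "c u = c v" using \<open>\<sigma> \<subseteq> V\<close> by (metis c_merge subsetD)
      with \<sigma>(3) \<open>u \<in> \<sigma>\<close> \<open>v \<in> \<sigma>\<close> show "u = v" by (simp add: inj_onD)
    qed
    let ?e = "m - ind (merge k ` \<sigma>)"
    have sub: "merge k ` \<sigma> \<subseteq> keys m" using \<sigma> by auto
    have "single (ind \<sigma>) (1::'k) \<in> supp_ideal U"
      using f\<sigma> \<sigma> by (intro single_in_supp_ideal) (simp add: keys_ind)
    then have "single (ind \<sigma>) (1::'k) \<in> quot U k"
      by (rule subsetD[OF plus_span_base[OF submodule_polys]])
    moreover have "single (ind \<sigma>) (1::'k) - single (rename_exp (merge k) (ind \<sigma>)) 1 \<in> quot U k"
      using single_diff_rename_exp[OF k, of "ind \<sigma>"] steps_subset_quot[OF U(1), of k] \<sigma> f\<sigma>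
      by (auto simp: keys_ind)
    ultimately have "single (ind (merge k ` \<sigma>)) (1::'k) \<in> quot U k"
      using submodule_diff[OF subring_polys submodule_quot[OF U(1)], of "single (ind \<sigma>) 1" k
          "single (ind \<sigma>) 1 - single (rename_exp (merge k) (ind \<sigma>)) 1"]
      by (simp add: rename_exp_ind[OF inj])
    moreover have "keys ?e \<subseteq> keys m" by (auto simp: in_keys_iff lookup_minus)
    then have "single ?e a \<in> polys V"
      using m by (intro single_in_supp_ideal) (auto simp: merged_def)
    ultimately have "single ?e a * single (ind (merge k ` \<sigma>)) 1 \<in> quot U k"
      using Q(3) by blast
    then show ?thesis by (simp add: mult_single add.commute ind_add_diff[OF sub])
  qed
  have "rename (merge k) p \<in> quot U k"
    by (rule submodule_monomials[OF submodule_quot[OF U(1)]], rule mono)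
      (use r in \<open>simp add: supp_ideal_def\<close>)
  moreover have "p - rename (merge k) p \<in> quot U k"
    using diff_rename_in_steps[OF k p] steps_subset_quot[OF U(1)] by blast
  ultimately show "p \<in> quot U k" using Q(2)[of "rename (merge k) p" "p - rename (merge k) p"] by simp
qed

text \<open>By \<open>quot_iff\<close> the claim concerns the merged ideal, where
  \<open>nonzerodivisor_mod_supp_ideal\<close> applies. For \<open>M\<close> outside
  \<open>merged k U\<close>, some \<open>N\<close> outside \<open>U\<close> contains the preimage of
  \<open>M\<close> and misses at most one variable of each fibre; so it contains
  \<open>ys ! k\<close> or all other variables of that fibre.\<close>

lemma regular_if_inj:
  assumes U: "upset V U" "inj_below U" "coinj_above U"
  shows "regular TYPE('k::field) U"
  unfolding regular_def nonzerodivisor_mod_def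
proof (intro allI impI ballI)
  fix k and p :: "('v, 'k) mpoly"
  assume k: "k < length ys" and p: "p \<in> polys V" and f: "step k * p \<in> quot U k"
  let ?y = "ys ! k"
  note y = nth_ys[OF k]
  have "nonzerodivisor_mod (polys V) (supp_ideal (merged k U)) (pvar (c ?y) - pvar ?y :: ('v, 'k) mpoly)"
  proof (rule nonzerodivisor_mod_supp_ideal[OF upset_merged[OF U(1)] cV[OF y(1)] y])
    fix M assume M: "M \<subseteq> V" "M \<notin> merged k U"
    let ?pre = "\<lambda>M. {v \<in> V. merge k v \<in> M}"
    have "?pre M \<notin> U" using M by (simp add: merged_def)
    then obtain N where N: "N \<subseteq> V" "?pre M \<subseteq> N" "N \<notin> U" "inj_on c (V - N)"
      using U(3) unfolding coinj_above_def by (metis (no_types, lifting) mem_Collect_eq subsetI)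
    have out: "insert z M \<notin> merged k U" if "z \<in> V" "?pre {z} \<subseteq> N" for z
    proof
      assume "insert z M \<in> merged k U"
      then have "?pre (insert z M) \<in> U" by (simp add: merged_def)
      moreover have "?pre (insert z M) \<subseteq> N" using N(2) that by auto
      ultimately show False using upsetD(2)[OF U(1)] N by blast
    qed
    show "insert (c ?y) M \<notin> merged k U \<or> insert ?y M \<notin> merged k U"
    proof (cases "?y \<in> N")
      case True
      \<comment> \<open>Values of \<open>c\<close> are fixed by \<open>c\<close>, but
        \<open>?y\<close> is not, so \<open>?y\<close> is its own only preimage under
        \<open>merge k\<close>.\<close>
      have "v = ?y" if "v \<in> V" "merge k v = ?y" for v
        using that y cc[of v] by (auto simp: merge_def split: if_splits)
      then show ?thesis using out[of ?y] True y by auto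
    next
      case False
      \<comment> \<open>Here \<open>v\<close> lies in the fibre of \<open>?y\<close>, but differs
        from it because \<open>?y\<close> is not yet merged at stage \<open>k\<close>.\<close>
      have "v \<in> N" if v: "v \<in> V" "merge k v = c ?y" for v
      proof (rule ccontr)
        assume "v \<notin> N"
        moreover have "c v = c ?y" using c_merge[of v k] v cc[OF y(1)] by simp
        ultimately have "v = ?y" using N(4) False v y by (auto dest: inj_onD)
        then show False using v y merge_nth_self[OF k] by simp
      qed
      then show ?thesis using out[of "c ?y"] cV y by auto
    qed
  qed
  moreover have "step k * rename (merge k) p \<in> supp_ideal (merged k U)"
    using f k p quot_iff[OF U(1,2), of k "step k * p"]
      submoduleD(3)[OF submodule_polys step_in_polys[OF k] p]
    by (simp add: rename_mult rename_step_self[OF k])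
  moreover have "rename (merge k) p \<in> polys V" using rename_in_polys[OF p, of "merge k"] merge_V by auto
  ultimately have "rename (merge k) p \<in> supp_ideal (merged k U)"
    by (simp add: nonzerodivisor_mod_def step_def)
  then show "p \<in> quot U k" using quot_iff[OF U(1,2) _ p, of k] k by simp
qed

section \<open>Necessity of the condition on generators\<close>

text \<open>\<open>R\<close> says that the image of the ideal under the identification of variables is square-free.\<close>

lemma inj_below_if_regular:
  assumes U: "upset V U" and reg: "regular TYPE('k::field) U"
    and R: "\<And>\<sigma>. \<sigma> \<in> U \<Longrightarrow> \<exists>\<sigma>'\<in>U. inj_on c \<sigma>' \<and> c ` \<sigma>' \<subseteq> c ` \<sigma>"
  shows "inj_below U"
  unfolding inj_below_def
proof
  let ?J = "supp_ideal U :: ('v, 'k) mpoly set"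
  fix \<sigma>1 assume \<sigma>1: "\<sigma>1 \<in> U"
  have "finite {\<tau> \<in> U. \<tau> \<subseteq> \<sigma>1}"
    using finite_subset[of \<sigma>1] upsetD(1)[OF U \<sigma>1] fin by (auto intro: finite_subset[of _ "Pow \<sigma>1"])
  then obtain \<sigma> where \<sigma>: "\<sigma> \<in> U" "\<sigma> \<subseteq> \<sigma>1"
      and min': "\<forall>\<tau>\<in>{\<tau> \<in> U. \<tau> \<subseteq> \<sigma>1}. \<tau> \<subseteq> \<sigma> \<longrightarrow> \<sigma> = \<tau>"
    using finite_has_minimal2[of "{\<tau> \<in> U. \<tau> \<subseteq> \<sigma>1}" \<sigma>1] \<sigma>1 by blast
  have min: "\<tau> = \<sigma>" if "\<tau> \<in> U" "\<tau> \<subseteq> \<sigma>" for \<tau>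
    using min' \<sigma> that by blast
  have \<sigma>V: "\<sigma> \<subseteq> V" by (rule upsetD(1)[OF U \<sigma>(1)])
  have fs: "finite \<sigma>" using \<sigma>V fin finite_subset by blast
  have "inj_on c \<sigma>"
  proof (rule ccontr)
    assume ninj: "\<not> inj_on c \<sigma>"
    obtain \<sigma>' where \<sigma>': "\<sigma>' \<in> U" "inj_on c \<sigma>'" "c ` \<sigma>' \<subseteq> c ` \<sigma>" using R[OF \<sigma>(1)] by blast
    have \<sigma>'V: "\<sigma>' \<subseteq> V" by (rule upsetD(1)[OF U \<sigma>'(1)])
    have fs': "finite \<sigma>'" using \<sigma>'V fin finite_subset by blast
    \<comment> \<open>A transversal of the fibres met by \<sigma>; since \<open>c\<close> is not
      injective on \<sigma>, some \<open>v\<close> is left over.\<close>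
    obtain \<tau> where \<tau>: "\<tau> \<subseteq> \<sigma>" "inj_on c \<tau>" "c ` \<tau> = c ` \<sigma>"
      using iffD1[OF subset_image_inj[of "c ` \<sigma>" c \<sigma>] order.refl] by (metis)
    have "\<tau> \<noteq> \<sigma>" using ninj \<tau>(2) by auto
    then obtain v where v: "v \<in> \<sigma>" "v \<notin> \<tau>" using \<tau>(1) by blast
    let ?c = "rename_exp c"
    \<comment> \<open>The cofactor for which the image of the monomial of \<sigma> is
      \<open>c v\<close> times the image of \<sigma>' times \<open>e\<close>. It involves only
      representatives, so \<open>c\<close> fixes it.\<close>
    define e where "e = ind (c ` \<sigma> - c ` \<sigma>') + ?c (ind (\<sigma> - \<tau> - {v}))"
    have ke: "keys e \<subseteq> c ` \<sigma>"
      using fs by (auto simp: e_def keys_add_nat keys_ind keys_rename_exp)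
    have ce: "?c e = e" using ke \<sigma>V cc by (intro rename_exp_ident) auto
    have "ind \<sigma> = ind \<tau> + (single v 1 + ind (\<sigma> - \<tau> - {v}))"
      using ind_subset[OF fs \<tau>(1)] ind_subset[of "\<sigma> - \<tau>" "{v}"] fs v by (simp add: ind_def)
    then have "?c (ind \<sigma>) = ?c (ind \<tau>) + (single (c v) 1 + ?c (ind (\<sigma> - \<tau> - {v})))"
      by (simp add: rename_exp_add)
    also have "?c (ind \<tau>) = ?c (ind \<sigma>') + ind (c ` \<sigma> - c ` \<sigma>')"
      using ind_subset[OF _ \<sigma>'(3)] fs by (simp add: rename_exp_ind \<tau> \<sigma>')
    finally have eq: "?c (ind \<sigma>) = single (c v) 1 + (?c (ind \<sigma>') + e)"
      by (simp add: e_def ac_simps)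
    \<comment> \<open>The monomials \<open>a\<close> and \<open>pvar (c v) * g\<close> of the ideal
      have the same image, so their difference lies in the ideal and in the kernel. By
      \<open>regular_plus_span_Int\<close> it then lies in the product of the two.\<close>
    define g where "g = single (ind \<sigma>' + e) (1::'k)"
    define a where "a = single (ind \<sigma>) (1::'k)"
    have gJ: "g \<in> ?J"
      unfolding g_def using ke \<sigma>V \<sigma>'V cV fs'
      by (intro single_in_supp_ideal upsetD(2)[OF U \<sigma>'(1)]) (auto simp: keys_add_nat keys_ind)
    have aJ: "a \<in> ?J" unfolding a_def using \<sigma> fs by (intro single_in_supp_ideal) (simp add: keys_ind)
    have pv: "pvar (c v) \<in> polys V" using v \<sigma>V cV by (intro pvar_in_polys) auto
    then have bJ: "pvar (c v) * g \<in> ?J" using supp_ideal_mult[OF U _ gJ] by blast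
    let ?r = "rename (merge (length ys))"
    have cong: "rename_exp (merge (length ys)) m = ?c m" if "keys m \<subseteq> V" for m
      using that by (auto simp: rename_exp_def merge_all intro!: sum.cong)
    have cv: "c (c v) = c v" using cc v \<sigma>V by blast
    have "?r a = ?r (pvar (c v) * g)"
      using ke \<sigma>V \<sigma>'V cV fs fs' cv v eq ce
      by (simp add: a_def g_def rename_mult cong keys_ind keys_add_nat rename_exp_add)
        (subst cong, auto simp: keys_add_nat keys_ind rename_exp_add pvar_def mult_single merge_all subset_iff)
    then have "a - pvar (c v) * g = (a - ?r a) - (pvar (c v) * g - ?r (pvar (c v) * g))" by simp
    also have "\<dots> \<in> steps (length ys)"
      using supp_ideal_subset_polys[OF U] aJ bJ
      by (intro submodule_diff[OF subring_polys submodule_steps] diff_rename_in_steps) auto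
    finally have "a - pvar (c v) * g \<in> steps (length ys)" .
    moreover have "a - pvar (c v) * g \<in> ?J"
      by (rule submodule_diff[OF subring_polys submodule_supp_ideal[OF U] aJ bJ])
    ultimately have d: "a - pvar (c v) * g \<in> plus_span {0} ?J step (length ys)"
      using reg U by (intro regular_plus_span_Int[OF subring_polys submodule_supp_ideal[OF U]]
          supp_ideal_subset_polys step_in_polys) (auto simp: regular_def)
    \<comment> \<open>A monomial of an element of the product ideal is a variable times a monomial
      of the ideal. Applied to \<sigma>, this contradicts minimality.\<close>
    have down: "\<exists>v\<in>\<sigma>. \<exists>j\<in>?J. ind \<sigma> - single v 1 \<in> keys j"
      if "d \<in> plus_span {0} ?J step k" "ind \<sigma> \<in> keys d" for d k
      using that
    proof (induction k arbitrary: d)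
      case (Suc k)
      then obtain p h where ph: "d = p + step k * h" "p \<in> plus_span {0} ?J step k" "h \<in> ?J" by auto
      show ?case
      proof (cases "ind \<sigma> \<in> keys p")
        case True
        then show ?thesis using Suc.IH ph by blast
      next
        case False
        then have "lookup (step k * h) (ind \<sigma>) \<noteq> 0" using Suc.prems ph by (simp add: in_keys_iff lookup_add)
        then have "\<exists>v. lookup (pvar v * h) (ind \<sigma>) \<noteq> 0"
          by (simp add: step_def left_diff_distrib lookup_minus) metis
        then obtain v where "v \<in> \<sigma>" "ind \<sigma> - single v 1 \<in> keys h"
          using fs by (auto simp: lookup_pvar_mult keys_ind in_keys_iff[of _ h] split: if_splits)
        with ph(3) show ?thesis by blast
      qed
    qed simp
    have "\<exists>v\<in>\<sigma>. \<exists>j\<in>?J. ind \<sigma> - single v 1 \<in> keys j"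
    proof (cases "ind \<sigma> \<in> keys (a - pvar (c v) * g)")
      case True
      then show ?thesis using down d by blast
    next
      \<comment> \<open>The monomial of \<sigma> has cancelled against
        \<open>pvar (c v) * g\<close>, so \<open>g\<close> itself provides the proper
        divisor.\<close>
      case False
      then have "lookup (pvar (c v) * g) (ind \<sigma>) = 1"
        by (simp add: in_keys_iff lookup_minus a_def)
      then have "c v \<in> \<sigma>" "ind \<sigma> - single (c v) 1 \<in> keys g"
        using fs by (auto simp: lookup_pvar_mult in_keys_iff[of _ g] keys_ind split: if_splits)
      then show ?thesis using gJ by blast
    qed
    then obtain w where w: "w \<in> \<sigma>" "keys (ind \<sigma> - single w 1) \<in> U" by (auto simp: supp_ideal_def)
    have "keys (ind \<sigma> - single w 1) \<subseteq> \<sigma> - {w}"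
      using fs by (auto simp: in_keys_iff lookup_minus lookup_ind split: if_splits)
    with min[OF w(2)] w(1) show False by blast
  qed
  with \<sigma> show "\<exists>\<sigma>'\<in>U. \<sigma>' \<subseteq> \<sigma>1 \<and> inj_on c \<sigma>'" by blast
qed

section \<open>Necessity of the condition on covers\<close>

lemma quot_truncate:
  "p \<in> quot U k \<Longrightarrow> upset V U \<Longrightarrow> truncate d p \<in> quot U k"
proof (induction k arbitrary: p d)
  case 0
  then show ?case by (simp add: supp_ideal_truncate)
next
  case (Suc k)
  then obtain q h where p: "p = q + step k * h" "q \<in> quot U k" "h \<in> polys V" by auto
  show ?case
  proof (cases d)
    case 0
    then show ?thesis using submoduleD(1)[OF submodule_quot[OF Suc.prems(2)], of "Suc k"] by simp
  next
    case (Suc d')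
    have "truncate d p = truncate d q + step k * truncate d' h"
      by (simp add: p Suc truncate_add step_def truncate_diff_mult)
    then show ?thesis using Suc.IH[OF p(2) Suc.prems(2)] supp_ideal_truncate[OF p(3)] by auto
  qed
qed

text \<open>The differences are removed from the modulus one at a time. The separation hypothesis
  holds by degree: if \<open>truncate d h = h\<close>, then truncating
  \<open>m + step k ^ d * s\<close> leaves a truncation of \<open>m\<close>, which stays in the
  graded ideal \<open>quot U k\<close>.\<close>

lemma nonzerodivisor_descend:
  assumes U: "upset V U" and reg: "regular TYPE('k::field) U"
    and b: "b \<le> length ys" and f: "f \<in> polys V"
    and nz: "nonzerodivisor_mod (polys V) (quot U b) (f :: ('v, 'k) mpoly)"
  shows "nonzerodivisor_mod (polys V) (supp_ideal U) f"
  using nz b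
proof (induction b)
  case (Suc k)
  have "nonzerodivisor_mod (polys V) (quot U k) f"
  proof (rule nonzerodivisor_mod_descend[OF subring_polys submodule_quot[OF U] step_in_polys f])
    show "k < length ys" using Suc.prems by simp
    then show "nonzerodivisor_mod (polys V) (quot U k) (step k :: ('v, 'k) mpoly)"
      using reg by (simp add: regular_def)
    show "nonzerodivisor_mod (polys V) {p + step k * h | p h. p \<in> quot U k \<and> h \<in> polys V} f"
      using Suc.prems(1) by simp
    fix h :: "('v, 'k) mpoly"
    assume sep: "\<And>t. \<exists>m\<in>quot U k. \<exists>s\<in>polys V. h = m + step k ^ t * s"
    obtain d where d: "truncate d h = h" using truncate_eq_self by blast
    obtain m s where ms: "m \<in> quot U k" "h = m + step k ^ d * s" using sep[of d] by blast
    have "truncate d h = truncate d m"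
      unfolding ms(2) by (simp add: truncate_add step_def truncate_diff_power_mult)
    then show "h \<in> quot U k" using quot_truncate[OF ms(1) U, of d] d by simp
  qed
  then show ?case using Suc by simp
qed simp

text \<open>For \<open>v = ys ! a\<close> with \<open>a < b\<close> the difference is
  \<open>step b - step a\<close>, and \<open>step a\<close> already lies in \<open>quot U b\<close>.
  So it acts like \<open>step b\<close> there, and \<open>nonzerodivisor_descend\<close> transfers
  this to the ideal itself.\<close>

lemma nonzerodivisor_fibre:
  assumes U: "upset V U" and reg: "regular TYPE('k::field) U"
    and b: "b < length ys" and v: "v = c (ys ! b) \<or> (\<exists>a<b. v = ys ! a \<and> c v = c (ys ! b))"
  shows "nonzerodivisor_mod (polys V) (supp_ideal U) (pvar v - pvar (ys ! b) :: ('v, 'k) mpoly)"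
proof (rule nonzerodivisor_descend[OF U reg, of b])
  let ?f = "pvar v - pvar (ys ! b) :: ('v, 'k) mpoly"
  have vV: "v \<in> V" using v nth_ys[of b] cV b nth_ys(1) by auto
  then show "?f \<in> polys V"
    using nth_ys[OF b] by (intro submodule_diff[OF subring_polys submodule_polys] pvar_in_polys)
  have rb: "nonzerodivisor_mod (polys V) (quot U b) (step b :: ('v, 'k) mpoly)"
    using reg b by (simp add: regular_def)
  show "nonzerodivisor_mod (polys V) (quot U b) ?f"
    using v
  proof (elim disjE exE conjE)
    fix a assume a: "a < b" "v = ys ! a" "c v = c (ys ! b)"
    have f: "step b = ?f + step a" using a by (simp add: step_def)
    show ?thesis unfolding nonzerodivisor_mod_def
    proof (intro ballI impI)
      fix p :: "('v, 'k) mpoly" assume p: "p \<in> polys V" "?f * p \<in> quot U b"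
      have "step a * p \<in> quot U b"
        by (rule plus_span_generator[OF submodule_polys submodule_supp_ideal[OF U] a(1) p(1)])
      then have "step b * p \<in> quot U b"
        using p submoduleD(2)[OF submodule_quot[OF U]] unfolding f distrib_right by blast
      then show "p \<in> quot U b" using rb p by (simp add: nonzerodivisor_mod_def)
    qed
  qed (use rb in \<open>simp add: step_def\<close>)
qed (use b in simp)

lemma coinj_above_if_regular:
  assumes U: "upset V U" and reg: "regular TYPE('k::field) U"
  shows "coinj_above U"
  unfolding coinj_above_def
proof (intro allI impI)
  let ?J = "supp_ideal U :: ('v, 'k) mpoly set"
  fix N1 assume N1: "N1 \<subseteq> V" "N1 \<notin> U"
  have "finite {M. M \<subseteq> V \<and> M \<notin> U}" using fin by simp
  then obtain N where N: "N \<subseteq> V" "N \<notin> U" "N1 \<subseteq> N"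
      and max: "\<forall>M\<in>{M. M \<subseteq> V \<and> M \<notin> U}. N \<subseteq> M \<longrightarrow> N = M"
    using finite_has_maximal2[of "{M. M \<subseteq> V \<and> M \<notin> U}" N1] N1 by blast
  have fN: "finite N" using N fin finite_subset by blast
  \<comment> \<open>By maximality of \<open>N\<close>, both \<open>u\<close> and \<open>v\<close>
    multiply the product of the variables in \<open>N\<close> into the ideal, which does not contain
    that product.\<close>
  have nz: False if "nonzerodivisor_mod (polys V) ?J (pvar u - pvar v)"
    "u \<in> V - N" "v \<in> V - N" for u v
  proof -
    define g where "g = single (ind N) (1::'k)"
    have wJ: "pvar w * g \<in> ?J" if w: "w \<in> V - N" for w
    proof -
      have "insert w N \<in> U" using max[rule_format, of "insert w N"] w N by auto
      then show ?thesis
        using fN by (simp add: g_def pvar_def mult_single supp_ideal_def keys_add_nat keys_ind)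
    qed
    have "(pvar u - pvar v) * g \<in> ?J"
      unfolding left_diff_distrib
      by (intro submodule_diff[OF subring_polys submodule_supp_ideal[OF U]] wJ that(2,3))
    moreover have "g \<in> polys V" using N fN by (simp add: g_def supp_ideal_def keys_ind)
    ultimately have "g \<in> ?J" using that(1) by (simp add: nonzerodivisor_mod_def)
    then show False using N fN by (simp add: g_def supp_ideal_def keys_ind)
  qed
  have "inj_on c (V - N)"
  proof (rule inj_onI, rule ccontr)
    have fixed: False
      if uv: "u \<in> V - N" "v \<in> V - N" "c u = c v" "u \<noteq> v" "c u = u" for u v
    proof -
      have "v \<in> set ys" using uv set_ys by auto
      then obtain b where "b < length ys" "v = ys ! b" by (auto simp: in_set_conv_nth)
      then show False using nonzerodivisor_fibre[OF U reg, of b u] nz[of u v] uv by auto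
    qed
    fix u v assume uv: "u \<in> V - N" "v \<in> V - N" "c u = c v" "u \<noteq> v"
    show False
    proof (cases "c u = u \<or> c v = v")
      case True
      then show False using fixed[of u v] fixed[of v u] uv by auto
    next
      case False
      then have "u \<in> set ys" "v \<in> set ys" using uv set_ys by auto
      then obtain a b where ab: "a < length ys" "u = ys ! a" "b < length ys" "v = ys ! b"
        by (auto simp: in_set_conv_nth)
      \<comment> \<open>\<open>nonzerodivisor_fibre\<close> needs the subtracted variable to be the
        later one in \<open>ys\<close>.\<close>
      then have "a < b \<or> b < a" using uv(4) by (cases a b rule: linorder_cases) auto
      then show False
        using nonzerodivisor_fibre[OF U reg, of b u] nonzerodivisor_fibre[OF U reg, of a v]
          nz[of u v] nz[of v u] uv ab by auto
    qed
  qed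
  with N show "\<exists>N'\<subseteq>V. N1 \<subseteq> N' \<and> N' \<notin> U \<and> inj_on c (V - N')" by blast
qed

end

section \<open>Ideals and regular sequences of the polynomial ring\<close>

lemma carrier_poly_ring: "carrier (poly_ring V) = polys V"
  by (auto simp: poly_ring_def supp_ideal_def)

lemma poly_ring_simps:
  "monoid.mult (poly_ring V) = (*)" "add (poly_ring V) = (+)" "zero (poly_ring V) = 0"
  by (simp_all add: poly_ring_def)

lemma sqfree_monomial_eq_ind: "finite \<sigma> \<Longrightarrow> sqfree_monomial \<sigma> = single (ind \<sigma>) 1"
  by (simp add: sqfree_monomial_eq_single ind_def)

lemma submodule_ideal: "ideal J (poly_ring V) \<Longrightarrow> submodule (polys V) J"
  using ideal.I_l_closed[of J "poly_ring V"] additive_subgroup.a_closed[OF ideal.axioms(1), of J "poly_ring V"]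
    additive_subgroup.zero_closed[OF ideal.axioms(1), of J "poly_ring V"]
  by (simp add: submodule_def carrier_poly_ring poly_ring_simps)

text \<open>One inclusion is minimality of the generated ideal; for the other, each monomial is a
  multiple of a generator, with cofactor \<open>m - ind \<sigma>\<close>.\<close>

lemma Idl_sqfree_monomials:
  assumes V: "finite V" "F \<subseteq> Pow V"
  shows "Idl\<^bsub>poly_ring V\<^esub> (sqfree_monomial ` F) =
    (supp_ideal {\<sigma>. \<sigma> \<subseteq> V \<and> (\<exists>\<sigma>'\<in>F. \<sigma>' \<subseteq> \<sigma>)} :: ('v, 'k::field) mpoly set)" (is "?I = supp_ideal ?U")
proof
  let ?P = "poly_ring V :: ('v, 'k) mpoly ring"
  interpret cring ?P by (rule cring_poly_ring)
  have sub: "sqfree_monomial ` F \<subseteq> carrier ?P"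
    by (rule image_subsetI, rule sqfree_monomial_in_carrier[OF V(1)]) (use V(2) in auto)
  have fin: "finite \<sigma>" if "\<sigma> \<in> F" for \<sigma> using that V finite_subset by blast
  have eq: "supp_ideal ?U = {p \<in> carrier ?P. \<forall>m \<in> keys p. \<exists>\<sigma>\<in>F. \<sigma> \<subseteq> keys m}"
    by (auto simp: carrier_poly_ring supp_ideal_def)
  have gen: "sqfree_monomial ` F \<subseteq> (supp_ideal ?U :: ('v, 'k) mpoly set)"
  proof (rule image_subsetI)
    fix \<sigma> assume "\<sigma> \<in> F"
    then show "(sqfree_monomial \<sigma> :: ('v, 'k) mpoly) \<in> supp_ideal ?U"
      using fin[of \<sigma>] V(2) by (auto simp: sqfree_monomial_eq_ind supp_ideal_def keys_ind)
  qed
  show "?I \<subseteq> supp_ideal ?U"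
    using gen unfolding eq by (rule genideal_minimal[OF ideal_sqfree_multiples[OF V]])
  have I: "submodule (polys V) ?I" by (rule submodule_ideal[OF genideal_ideal[OF sub]])
  show "supp_ideal ?U \<subseteq> ?I"
  proof
    fix p :: "('v, 'k) mpoly" assume p: "p \<in> supp_ideal ?U"
    show "p \<in> ?I"
    proof (rule submodule_monomials[OF I])
      fix m assume "m \<in> keys p"
      with p obtain \<sigma> where \<sigma>: "\<sigma> \<in> F" "\<sigma> \<subseteq> keys m" "keys m \<subseteq> V" by (auto simp: supp_ideal_def)
      have "keys (m - ind \<sigma>) \<subseteq> keys m" by (auto simp: in_keys_iff lookup_minus)
      then have "single (m - ind \<sigma>) (lookup p m) \<in> polys V"
        using \<sigma> by (intro single_in_supp_ideal) auto
      moreover have "single (ind \<sigma>) 1 \<in> ?I"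
        using genideal_self[OF sub] \<sigma>(1) fin[OF \<sigma>(1)] by (auto simp flip: sqfree_monomial_eq_ind)
      ultimately have "single (m - ind \<sigma>) (lookup p m) * single (ind \<sigma>) 1 \<in> ?I"
        by (rule submoduleD(3)[OF I])
      then show "single m (lookup p m) \<in> ?I"
        by (simp add: mult_single add.commute ind_add_diff[OF \<sigma>(2)])
    qed
  qed
qed

lemma Idl_sqfree_monomials_upset:
  assumes "finite V" "upset V U"
  shows "Idl\<^bsub>poly_ring V\<^esub> (sqfree_monomial ` U) = supp_ideal U"
proof -
  have "{\<sigma>. \<sigma> \<subseteq> V \<and> (\<exists>\<sigma>'\<in>U. \<sigma>' \<subseteq> \<sigma>)} = U" using assms(2) unfolding upset_def by blast
  then show ?thesis using Idl_sqfree_monomials[of V U] assms by (simp add: upset_def)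
qed

lemma sqfree_monomial_ideal_iff:
  assumes "finite V"
  shows "sqfree_monomial_ideal V J \<longleftrightarrow> (\<exists>U. upset V U \<and> J = supp_ideal U)"
proof
  assume "sqfree_monomial_ideal V J"
  then obtain F where F: "F \<subseteq> Pow V" "J = Idl\<^bsub>poly_ring V\<^esub> (sqfree_monomial ` F)"
    by (auto simp: sqfree_monomial_ideal_def)
  have "upset V {\<sigma>. \<sigma> \<subseteq> V \<and> (\<exists>\<sigma>'\<in>F. \<sigma>' \<subseteq> \<sigma>)}" unfolding upset_def by blast
  then show "\<exists>U. upset V U \<and> J = supp_ideal U" using F Idl_sqfree_monomials[OF assms F(1)] by blast
next
  assume "\<exists>U. upset V U \<and> J = supp_ideal U"
  then show "sqfree_monomial_ideal V J"
    using Idl_sqfree_monomials_upset[OF assms] by (auto simp: sqfree_monomial_ideal_def upset_def)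
qed

lemma monomial_ideal_supp_ideal:
  assumes V: "finite V" and U: "upset V U"
  shows "monomial_ideal V (supp_ideal U)"
proof -
  have fin: "finite \<sigma>" if "\<sigma> \<in> U" for \<sigma> using upsetD(1)[OF U that] V finite_subset by blast
  have "sqfree_monomial ` U = (\<lambda>m. single m 1) ` (ind ` U)"
    unfolding image_image by (rule image_cong) (auto simp: sqfree_monomial_eq_ind fin)
  moreover have "ind ` U \<subseteq> {m. keys m \<subseteq> V}"
    by (rule image_subsetI) (use fin upsetD(1)[OF U] in \<open>simp add: keys_ind\<close>)
  ultimately show ?thesis
    unfolding monomial_ideal_def Idl_sqfree_monomials_upset[OF V U, symmetric] by metis
qed

text \<open>For an upset these are the sets that meet every member: \<tau> misses a member iff its
  complement contains one.\<close>

definition dual_upset :: "'v set \<Rightarrow> 'v set set \<Rightarrow> 'v set set" where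
  "dual_upset V U = {\<tau>. \<tau> \<subseteq> V \<and> V - \<tau> \<notin> U}"

lemma upset_dual:
  assumes "upset V U" shows "upset V (dual_upset V U)"
  unfolding upset_def dual_upset_def
proof (intro conjI ballI allI impI CollectI)
  fix \<sigma> \<tau> assume "\<sigma> \<in> {\<tau>. \<tau> \<subseteq> V \<and> V - \<tau> \<notin> U}" "\<sigma> \<subseteq> \<tau>" "\<tau> \<subseteq> V"
  then show "V - \<tau> \<notin> U" using upsetD(2)[OF assms, of "V - \<tau>" "V - \<sigma>"] by blast
qed auto

lemma alexander_dual_supp_ideal:
  assumes V: "finite V" and U: "upset V U"
  shows "alexander_dual V (supp_ideal U) = (supp_ideal (dual_upset V U) :: ('v, 'k::field) mpoly set)"
proof -
  have mem: "(sqfree_monomial \<sigma> :: ('v, 'k) mpoly) \<in> supp_ideal U \<longleftrightarrow> \<sigma> \<in> U" if "\<sigma> \<subseteq> V" for \<sigma>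
    using finite_subset[OF that V] by (simp add: sqfree_monomial_eq_ind supp_ideal_def keys_ind)
  have "(\<forall>\<sigma>\<subseteq>V. (sqfree_monomial \<sigma> :: ('v, 'k) mpoly) \<in> supp_ideal U \<longrightarrow> \<tau> \<inter> \<sigma> \<noteq> {}) \<longleftrightarrow>
      (\<forall>\<sigma>\<in>U. \<tau> \<inter> \<sigma> \<noteq> {})" for \<tau>
    by (metis mem upsetD(1)[OF U])
  then have "{\<tau>. \<tau> \<subseteq> V \<and> (\<forall>\<sigma>\<subseteq>V. (sqfree_monomial \<sigma> :: ('v, 'k) mpoly) \<in> supp_ideal U \<longrightarrow> \<tau> \<inter> \<sigma> \<noteq> {})} =
      {\<tau>. \<tau> \<subseteq> V \<and> (\<forall>\<sigma>\<in>U. \<tau> \<inter> \<sigma> \<noteq> {})}"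
    by simp
  also have "\<dots> = dual_upset V U"
  proof -
    have "(\<forall>\<sigma>\<in>U. \<tau> \<inter> \<sigma> \<noteq> {}) \<longleftrightarrow> V - \<tau> \<notin> U" if "\<tau> \<subseteq> V" for \<tau>
    proof
      assume "V - \<tau> \<notin> U"
      then show "\<forall>\<sigma>\<in>U. \<tau> \<inter> \<sigma> \<noteq> {}" using upsetD[OF U] by (metis Diff_subset Diff_triv Diff_mono inf_commute order.refl)
    qed blast
    then show ?thesis by (auto simp: dual_upset_def)
  qed
  finally show ?thesis
    unfolding alexander_dual_def using Idl_sqfree_monomials_upset[OF V upset_dual[OF U]] by simp
qed

section \<open>Regular sequences on the quotient module in terms of ideals\<close>

lemma plus_span_cong:
  "(\<And>i. i < k \<Longrightarrow> f i = g i) \<Longrightarrow> plus_span M N f k = plus_span M N g k"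
  by (induction k) auto

text \<open>The submodule generated by the first k elements is the image of their ideal under the
  coset map \<open>h\<close>; its preimage is that ideal plus \<open>J\<close>.\<close>

lemma regular_sequence_quotient_iff:
  fixes J :: "('v, 'k::field) mpoly set"
  assumes J: "ideal J (poly_ring V)" and fs: "set fs \<subseteq> polys V"
  shows "regular_sequence (poly_ring V) (quotient_module (poly_ring V) J) fs \<longleftrightarrow>
    (\<forall>k<length fs. nonzerodivisor_mod (polys V) (plus_span J (polys V) ((!) fs) k) (fs ! k))"
proof -
  let ?P = "poly_ring V :: ('v, 'k) mpoly ring" and ?C = "polys V :: ('v, 'k) mpoly set"
  let ?M = "quotient_module ?P J"
  interpret P: cring ?P by (rule cring_poly_ring)
  interpret J: ideal J ?P by fact
  interpret M: module ?P ?M by (rule quotient_module_module[OF P.cring_axioms J])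
  define h where "h p = J +>\<^bsub>?P\<^esub> p" for p
  have SJ: "submodule ?C J" by (rule submodule_ideal[OF J])
  have carM: "carrier ?M = h ` ?C"
    by (auto simp: quotient_module_def FactRing_def A_RCOSETS_def' h_def carrier_poly_ring)
  have hadd: "h p \<oplus>\<^bsub>?M\<^esub> h q = h (p + q)" if "p \<in> ?C" "q \<in> ?C" for p q
    using J.a_rcos_sum[of p q] that
    by (simp add: quotient_module_def FactRing_def h_def carrier_poly_ring poly_ring_simps)
  have hsm: "f \<odot>\<^bsub>?M\<^esub> h p = h (f * p)" if "f \<in> ?C" "p \<in> ?C" for f p
    using J.rcoset_mult_add[of f p] that
    by (simp add: quotient_module_def FactRing_def h_def carrier_poly_ring poly_ring_simps)
  have h0: "\<zero>\<^bsub>?M\<^esub> = h 0"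
    using P.a_coset_add_zero[OF J.a_subset]
    by (simp add: quotient_module_def FactRing_def h_def poly_ring_simps)
  have heq: "h p = h q \<longleftrightarrow> p - q \<in> J" if "p \<in> ?C" "q \<in> ?C" for p q
  proof
    assume "h p = h q"
    then have "p \<in> h q" using J.a_rcos_self[of p] that by (simp add: h_def carrier_poly_ring)
    then show "p - q \<in> J" by (auto simp: h_def a_r_coset_def' poly_ring_simps)
  next
    assume "p - q \<in> J"
    then have "p \<in> h q" by (auto simp: h_def a_r_coset_def' poly_ring_simps intro!: bexI[of _ "p - q"])
    then show "h p = h q" using P.a_repr_independence[OF _ _ J.a_subgroup, of p q] that by (simp add: h_def carrier_poly_ring)
  qed
  have fC: "fs ! i \<in> ?C" if "i < length fs" for i using fs that nth_mem by blast
  let ?S = "plus_span {0} ?C ((!) fs)"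
  have "(0 :: ('v, 'k) mpoly) \<in> ?C" by (simp add: supp_ideal_def)
  then have SC: "?S k \<subseteq> ?C" if "k \<le> length fs" for k
    by (intro plus_span_subset[OF submodule_polys submodule_zero]) (use fC that in auto)
  have mC: "f * p \<in> ?C" if "f \<in> ?C" "p \<in> ?C" for f p
    using submoduleD(3)[OF submodule_polys] that by blast
  define sm where "sm k x = (\<Oplus>\<^bsub>?M\<^esub>i\<in>{..<k}. fs ! i \<odot>\<^bsub>?M\<^esub> x i)" for k x
  have sm_Suc: "sm (Suc k) x = fs ! k \<odot>\<^bsub>?M\<^esub> x k \<oplus>\<^bsub>?M\<^esub> sm k x"
    if "Suc k \<le> length fs" "x \<in> {..<Suc k} \<rightarrow> carrier ?M" for k x
    unfolding sm_def lessThan_Suc using that fC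
    by (subst M.finsum_insert) (auto simp: carrier_poly_ring intro!: M.smult_closed)
  have sm1: "\<exists>l\<in>?S k. sm k x = h l" if "k \<le> length fs" "x \<in> {..<k} \<rightarrow> carrier ?M" for k x
    using that
  proof (induction k)
    case 0
    then show ?case by (simp add: sm_def h0)
  next
    case (Suc k)
    have "x \<in> {..<k} \<rightarrow> carrier ?M" using Suc.prems by auto
    then obtain l where l: "l \<in> ?S k" "sm k x = h l" using Suc.IH Suc.prems by auto
    have "x k \<in> carrier ?M" using Suc.prems by auto
    then obtain p where p: "p \<in> ?C" "x k = h p" by (auto simp: carM)
    have "sm (Suc k) x = h (l + fs ! k * p)"
      using sm_Suc[OF Suc.prems] l p fC[of k] Suc.prems SC[of k] mC[of "fs ! k" p]
      by (simp add: hsm hadd subset_iff add.commute)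
    then show ?case using l p by auto
  qed
  have sm2: "\<exists>x\<in>{..<k} \<rightarrow> carrier ?M. sm k x = h l" if "k \<le> length fs" "l \<in> ?S k" for k l
    using that
  proof (induction k arbitrary: l)
    case 0
    then show ?case by (simp add: sm_def h0)
  next
    case (Suc k)
    then obtain q p where l: "l = q + fs ! k * p" "q \<in> ?S k" "p \<in> ?C" by auto
    then obtain x where x: "x \<in> {..<k} \<rightarrow> carrier ?M" "sm k x = h q"
      using Suc.IH[of q] Suc.prems by auto
    \<comment> \<open>The new coefficient at index \<open>k\<close> leaves the partial sum of the
      first \<open>k\<close> terms unchanged.\<close>
    let ?x = "x(k := h p)"
    have "h p \<in> carrier ?M" using l(3) by (simp add: carM)
    with x(1) have x': "?x \<in> {..<Suc k} \<rightarrow> carrier ?M" by (auto simp: less_Suc_eq Pi_iff)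
    have "sm k ?x = sm k x"
      unfolding sm_def using x fC Suc.prems
      by (intro M.finsum_cong') (auto simp: carrier_poly_ring intro!: M.smult_closed)
    then have "sm (Suc k) ?x = h l"
      using sm_Suc[OF Suc.prems(1) x'] l x fC[of k] Suc.prems SC[of k] mC[of "fs ! k" p]
      by (simp add: hsm hadd subset_iff add.commute)
    then show ?case using x' by blast
  qed
  have list_smult_eq: "list_smult (take k fs) ?M = h ` ?S k" if k: "k \<le> length fs" for k
  proof -
    have eq: "(\<Oplus>\<^bsub>?M\<^esub>i\<in>{..<k}. take k fs ! i \<odot>\<^bsub>?M\<^esub> x i) = sm k x"
      if "x \<in> {..<k} \<rightarrow> carrier ?M" for x
      unfolding sm_def using that fC k
      by (intro M.finsum_cong') (auto simp: carrier_poly_ring intro!: M.smult_closed)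
    have len: "length (take k fs) = k" using k by simp
    show ?thesis
    proof (intro equalityI subsetI)
      fix X assume "X \<in> list_smult (take k fs) ?M"
      then obtain x where "x \<in> {..<k} \<rightarrow> carrier ?M" "X = sm k x"
        unfolding list_smult_def len using eq by blast
      then show "X \<in> h ` ?S k" using sm1[OF k] by blast
    next
      fix X assume "X \<in> h ` ?S k"
      then obtain x where x: "x \<in> {..<k} \<rightarrow> carrier ?M" "X = sm k x" using sm2[OF k] by blast
      then show "X \<in> list_smult (take k fs) ?M"
        unfolding list_smult_def len using eq[OF x(1)] by blast
    qed
  qed
  have mem: "h p \<in> list_smult (take k fs) ?M \<longleftrightarrow> p \<in> plus_span J ?C ((!) fs) k"
    if k: "k \<le> length fs" and p: "p \<in> ?C" for k p
  proof
    assume "h p \<in> list_smult (take k fs) ?M"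
    then obtain l where l: "l \<in> ?S k" "h p = h l" using list_smult_eq[OF k] by auto
    then have "p - l \<in> J" using heq[OF p] SC[OF k] by blast
    then have "p - l \<in> plus_span J ?C ((!) fs) k" using plus_span_base[OF submodule_polys] by blast
    moreover have "l \<in> plus_span J ?C ((!) fs) k"
      using plus_span_mono_base[of "{0}" J ?C "(!) fs" k] l submoduleD(1)[OF SJ] by auto
    ultimately have "p - l + l \<in> plus_span J ?C ((!) fs) k"
      by (rule submoduleD(2)[OF submodule_plus_span[OF SJ submodule_polys]])
    then show "p \<in> plus_span J ?C ((!) fs) k" by simp
  next
    assume "p \<in> plus_span J ?C ((!) fs) k"
    then obtain j l where l: "p = j + l" "j \<in> J" "l \<in> ?S k" using plus_span_decompose by blast
    then have "h p = h l" using heq[OF p, of l] SC[OF k] by auto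
    then show "h p \<in> list_smult (take k fs) ?M" using list_smult_eq[OF k] l by auto
  qed
  show ?thesis
    unfolding regular_sequence_def nonzerodivisor_mod_def carM carrier_poly_ring
    using fs fC mC by (simp add: hsm mem)
qed

section \<open>The variables of a polarization\<close>

lemma finite_pol_vars: "finite (pol_vars n r)"
proof -
  have "pol_vars n r = Sigma {1..n} (\<lambda>i. {1..r i})" by (auto simp: pol_vars_def)
  then show ?thesis by simp
qed

definition pol_base :: "nat \<times> nat \<Rightarrow> nat \<times> nat" where
  "pol_base v = (fst v, 1)"

text \<open>The subtracted variables, in the order in which \<open>pol_sequence\<close> uses
  them.\<close>

definition pol_rest :: "nat \<Rightarrow> (nat \<Rightarrow> nat) \<Rightarrow> (nat \<times> nat) list" where
  "pol_rest n r = concat (map (\<lambda>i. map (Pair i) [2..<Suc (r i)]) [1..<Suc n])"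

lemma set_pol_rest: "set (pol_rest n r) = {v \<in> pol_vars n r. pol_base v \<noteq> v}"
proof -
  have "(i, j) \<in> set (pol_rest n r) \<longleftrightarrow> 1 \<le> i \<and> i \<le> n \<and> 2 \<le> j \<and> j \<le> r i" for i j
    by (auto simp: pol_rest_def image_iff simp del: upt_Suc)
  then show ?thesis by (auto simp: pol_vars_def pol_base_def)
qed

lemma distinct_pol_rest: "distinct (pol_rest n r)"
proof (induction n)
  case (Suc n)
  have "pol_rest (Suc n) r = pol_rest n r @ map (Pair (Suc n)) [2..<Suc (r (Suc n))]"
    by (simp add: pol_rest_def)
  moreover have "v \<notin> set (pol_rest n r)" if "fst v = Suc n" for v
    using that by (auto simp: pol_rest_def)
  ultimately show ?case using Suc by (auto simp: distinct_map inj_on_def simp del: upt_Suc)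
qed (simp add: pol_rest_def)

lemma pol_sequence_eq: "pol_sequence n r = map (\<lambda>v. pvar (pol_base v) - pvar v) (pol_rest n r)"
  by (simp add: pol_sequence_def pol_rest_def pol_base_def map_concat comp_def)

lemma inj_on_pol_base: "inj_on pol_base \<sigma> \<longleftrightarrow> inj_on fst \<sigma>"
  by (simp add: inj_on_def pol_base_def)

lemma merging_pol_vars:
  assumes "\<And>i. i \<in> {1..n} \<Longrightarrow> r i \<ge> 1"
  shows "merging (pol_vars n r) pol_base (pol_rest n r)"
proof unfold_locales
  fix v assume "v \<in> pol_vars n r"
  then show "pol_base v \<in> pol_vars n r"
    using assms[of "fst v"] by (auto simp: pol_vars_def pol_base_def)
qed (simp_all add: finite_pol_vars distinct_pol_rest set_pol_rest, simp add: pol_base_def)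

lemma psubst_eq_rename: "psubst (\<lambda>(i, j). pvar i) = rename fst"
  unfolding rename_def by (rule arg_cong[of _ _ psubst]) auto

text \<open>By \<open>A\<close> the ideal is generated by monomials whose images stay square-free.\<close>

lemma rename_fst_supp_ideal:
  assumes r: "\<And>i. i \<in> {1..n} \<Longrightarrow> r i \<ge> 1" and U: "upset (pol_vars n r) U"
    and A: "\<And>\<sigma>. \<sigma> \<in> U \<Longrightarrow> \<exists>\<sigma>'\<in>U. \<sigma>' \<subseteq> \<sigma> \<and> inj_on fst \<sigma>'"
  shows "rename fst ` supp_ideal U = (supp_ideal
    {\<rho>. \<rho> \<subseteq> {1..n} \<and> {v \<in> pol_vars n r. fst v \<in> \<rho>} \<in> U} :: (nat, 'k::field) mpoly set)"
    (is "_ = supp_ideal ?U")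
proof (intro equalityI subsetI)
  let ?V = "pol_vars n r"
  fix q :: "(nat, 'k) mpoly" assume "q \<in> rename fst ` supp_ideal U"
  then obtain p where p: "p \<in> supp_ideal U" "q = rename fst p" by blast
  have "fst ` keys m \<in> ?U" if "m \<in> keys p" for m
  proof -
    have m: "keys m \<in> U" using p that by (simp add: supp_ideal_def)
    have "{v \<in> ?V. fst v \<in> fst ` keys m} \<in> U"
      by (rule upsetD(2)[OF U m]) (use upsetD(1)[OF U m] in auto)
    then show ?thesis using upsetD(1)[OF U m] by (auto simp: pol_vars_def)
  qed
  then have "keys (rename_exp fst m) \<in> ?U" if "m \<in> keys p" for m
    using that unfolding keys_rename_exp by blast
  then show "q \<in> supp_ideal ?U"
    using keys_rename[of fst p] unfolding supp_ideal_def p(2) by blast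
next
  let ?V = "pol_vars n r"
  fix q :: "(nat, 'k) mpoly" assume q: "q \<in> supp_ideal ?U"
  have "\<exists>p\<in>supp_ideal U. rename fst p = single m (lookup q m)" if "m \<in> keys q" for m
  proof -
    have m: "keys m \<subseteq> {1..n}" "{v \<in> ?V. fst v \<in> keys m} \<in> U"
      using q that by (auto simp: supp_ideal_def)
    from A[OF m(2)] obtain \<sigma> where \<sigma>: "\<sigma> \<in> U" "\<sigma> \<subseteq> {v \<in> ?V. fst v \<in> keys m}" "inj_on fst \<sigma>" by blast
    have f\<sigma>: "finite \<sigma>" by (rule finite_subset[OF _ finite_pol_vars[of n r]]) (use \<sigma> in auto)
    define e where "e = m - ind (fst ` \<sigma>)"
    have ke: "keys e \<subseteq> keys m" by (auto simp: e_def in_keys_iff lookup_minus)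
    \<comment> \<open>The cofactor is lifted to the variables with second index 1, which exist
      because \<open>r i \<ge> 1\<close>.\<close>
    define e' where "e' = rename_exp (\<lambda>i. (i, 1::nat)) e"
    have "rename_exp fst e' = e" unfolding e'_def rename_exp_comp by (rule rename_exp_ident) simp
    then have "rename fst (single (ind \<sigma> + e') (lookup q m)) = single (ind (fst ` \<sigma>) + e) (lookup q m)"
      by (simp add: rename_exp_add rename_exp_ind[OF \<sigma>(3)])
    also have "ind (fst ` \<sigma>) + e = m" unfolding e_def by (rule ind_add_diff) (use \<sigma> in auto)
    finally have "rename fst (single (ind \<sigma> + e') (lookup q m)) = single m (lookup q m)" .
    moreover have "keys e' \<subseteq> ?V"
      using ke m(1) r by (force simp: e'_def keys_rename_exp pol_vars_def)
    then have "keys (ind \<sigma> + e') \<in> U"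
      using \<sigma> f\<sigma> by (intro upsetD(2)[OF U \<sigma>(1)]) (auto simp: keys_add_nat keys_ind)
    ultimately show ?thesis using single_in_supp_ideal by blast
  qed
  then obtain p where p: "\<And>m. m \<in> keys q \<Longrightarrow> p m \<in> supp_ideal U"
      "\<And>m. m \<in> keys q \<Longrightarrow> rename fst (p m) = single m (lookup q m)" by metis
  have "rename fst (sum p A) = (\<Sum>m\<in>A. rename fst (p m))" for A
    by (induction A rule: infinite_finite_induct) (auto simp: rename_add)
  then have "rename fst (sum p (keys q)) = q"
    using p(2) poly_mapping_sum_monomials[of q] by simp
  moreover have "sum p (keys q) \<in> supp_ideal U"
    by (rule submodule_sum[OF submodule_supp_ideal[OF U] p(1)])
  ultimately show "q \<in> rename fst ` supp_ideal U" by (metis imageI)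
qed

section \<open>Duality and the proof of the theorem\<close>

context merging
begin

lemma regular_sequence_iff_regular:
  fixes fs :: "('v, 'k::field) mpoly list"
  assumes U: "upset V U" and fs: "fs = map (\<lambda>v. pvar (c v) - pvar v) ys"
  shows "regular_sequence (poly_ring V) (quotient_module (poly_ring V) (supp_ideal U)) fs
    \<longleftrightarrow> regular TYPE('k) U"
proof -
  have step: "fs ! i = step i" if "i < length ys" for i
    using that by (simp add: fs step_def)
  have sub: "set fs \<subseteq> polys V"
    using step step_in_polys by (auto simp: in_set_conv_nth fs)
  have "sqfree_monomial ` U \<subseteq> carrier (poly_ring V :: ('v, 'k) mpoly ring)"
    using upsetD(1)[OF U] sqfree_monomial_in_carrier[OF fin] by blast
  then have "ideal (supp_ideal U) (poly_ring V :: ('v, 'k) mpoly ring)"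
    unfolding Idl_sqfree_monomials_upset[OF fin U, symmetric]
    by (rule ring.genideal_ideal[OF cring.axioms(1)[OF cring_poly_ring]])
  moreover have "plus_span (supp_ideal U) (polys V) ((!) fs) k = quot U k" if "k < length ys" for k
    by (rule plus_span_cong) (use that step in auto)
  ultimately show ?thesis
    using step by (simp add: regular_sequence_quotient_iff sub regular_def) (simp add: fs)
qed

text \<open>Complementation in \<open>V\<close> exchanges the non-members of \<open>U\<close> with
  the members of the dual.\<close>

lemma inj_below_dual:
  assumes "coinj_above U" shows "inj_below (dual_upset V U)"
  unfolding inj_below_def
proof
  fix \<sigma> assume "\<sigma> \<in> dual_upset V U"
  then obtain N where N: "N \<subseteq> V" "V - \<sigma> \<subseteq> N" "N \<notin> U" "inj_on c (V - N)"
    using assms[unfolded coinj_above_def, rule_format, of "V - \<sigma>"] by (auto simp: dual_upset_def)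
  have "V - (V - N) = N" using N(1) by blast
  then have "V - N \<in> dual_upset V U" using N(3) by (simp add: dual_upset_def)
  with N show "\<exists>\<sigma>'\<in>dual_upset V U. \<sigma>' \<subseteq> \<sigma> \<and> inj_on c \<sigma>'" by blast
qed

lemma coinj_above_dual:
  assumes "upset V U" "inj_below U" shows "coinj_above (dual_upset V U)"
  unfolding coinj_above_def
proof (intro allI impI)
  fix N assume N: "N \<subseteq> V" "N \<notin> dual_upset V U"
  then obtain \<sigma> where \<sigma>: "\<sigma> \<in> U" "\<sigma> \<subseteq> V - N" "inj_on c \<sigma>"
    using assms(2) unfolding inj_below_def dual_upset_def by blast
  have "V - (V - \<sigma>) = \<sigma>" using \<sigma>(2) by blast
  with \<sigma> N show "\<exists>N'\<subseteq>V. N \<subseteq> N' \<and> N' \<notin> dual_upset V U \<and> inj_on c (V - N')"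
    by (intro exI[of _ "V - \<sigma>"]) (auto simp: dual_upset_def)
qed

end

theorem theorem3p1:
  fixes n :: nat and r :: "nat \<Rightarrow> nat"
    and I :: "(nat, 'k::field) mpoly set"
    and I' :: "(nat \<times> nat, 'k) mpoly set"
  assumes "sqfree_monomial_ideal {1..n} I"
    and "polarization n r I I'"
  shows "polarization n r (alexander_dual {1..n} I) (alexander_dual (pol_vars n r) I')"
proof -
  let ?V = "pol_vars n r"
  have r: "r i \<ge> 1" if "i \<in> {1..n}" for i using assms(2) that by (auto simp: polarization_def)
  interpret merging ?V pol_base "pol_rest n r" by (rule merging_pol_vars[OF r])
  obtain U0 where U0: "upset {1..n} U0" "I = supp_ideal U0"
    using assms(1) sqfree_monomial_ideal_iff[of "{1..n}" I] by auto
  obtain U where U: "upset ?V U" and I': "I' = supp_ideal U"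
    using assms(2) sqfree_monomial_ideal_iff[OF fin, of I'] by (auto simp: polarization_def)
  have reg: "regular TYPE('k) U"
    using assms(2) regular_sequence_iff_regular[where 'k = 'k, OF U pol_sequence_eq] by (simp add: polarization_def I')
  have img: "rename fst ` (supp_ideal U :: (nat \<times> nat, 'k) mpoly set) = I"
    using assms(2) by (simp add: polarization_def I' psubst_eq_rename)
  have R: "\<exists>\<sigma>'\<in>U. inj_on pol_base \<sigma>' \<and> pol_base ` \<sigma>' \<subseteq> pol_base ` \<sigma>" if \<sigma>: "\<sigma> \<in> U" for \<sigma>
  proof -
    have f\<sigma>: "finite \<sigma>" using upsetD(1)[OF U \<sigma>] fin finite_subset by blast
    have "single (ind \<sigma>) (1::'k) \<in> supp_ideal U"
      using \<sigma> f\<sigma> by (simp add: supp_ideal_def keys_ind)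
    then have "rename fst (single (ind \<sigma>) (1::'k)) \<in> I" using img by blast
    then have "fst ` \<sigma> \<in> U0" using f\<sigma> by (simp add: U0 supp_ideal_def keys_rename_exp keys_ind)
    then have "single (ind (fst ` \<sigma>)) (1::'k) \<in> I" using f\<sigma> by (simp add: U0 supp_ideal_def keys_ind)
    then obtain g :: "(nat \<times> nat, 'k) mpoly"
      where g: "g \<in> supp_ideal U" "rename fst g = single (ind (fst ` \<sigma>)) 1"
      using img by (metis imageE)
    then have "ind (fst ` \<sigma>) \<in> rename_exp fst ` keys g" using keys_rename[of fst g] by simp
    then obtain m where m: "m \<in> keys g" "rename_exp fst m = ind (fst ` \<sigma>)" by auto
    have "inj_on fst (keys m)"
      by (rule lookup_rename_exp_inj) (use f\<sigma> in \<open>simp add: m(2) lookup_ind\<close>)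
    moreover have "fst ` keys m = fst ` \<sigma>"
      using keys_rename_exp[of fst m] f\<sigma> by (simp add: m(2) keys_ind)
    then have "(\<lambda>i. (i, Suc 0)) ` fst ` keys m = (\<lambda>i. (i, Suc 0)) ` fst ` \<sigma>" by (rule arg_cong)
    then have "pol_base ` keys m = pol_base ` \<sigma>"
      by (simp add: pol_base_def image_image)
    moreover have "keys m \<in> U" using g(1) m(1) by (simp add: supp_ideal_def)
    ultimately show ?thesis by (auto simp: inj_on_pol_base)
  qed
  have A: "inj_below U" by (rule inj_below_if_regular[OF U reg R])
  have B: "coinj_above U" by (rule coinj_above_if_regular[OF U reg])
  let ?W = "dual_upset ?V U"
  have W: "upset ?V ?W" by (rule upset_dual[OF U])
  have AW: "inj_below ?W" by (rule inj_below_dual[OF B])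
  have BW: "coinj_above ?W" by (rule coinj_above_dual[OF U A])
  let ?pre = "\<lambda>\<rho>. {v \<in> ?V. fst v \<in> \<rho>}"
  \<comment> \<open>Describing \<open>I\<close> through \<open>U\<close> makes its dual comparable
    with the image of the dual of \<open>I'\<close>.\<close>
  let ?U1 = "{\<rho>. \<rho> \<subseteq> {1..n} \<and> ?pre \<rho> \<in> U}"
  have U1: "upset {1..n} ?U1"
    unfolding upset_def
  proof (intro conjI ballI allI impI CollectI)
    fix \<sigma> \<tau> assume "\<sigma> \<in> ?U1" "\<sigma> \<subseteq> \<tau>"
    then show "?pre \<tau> \<in> U" using upsetD(2)[OF U, of "?pre \<sigma>" "?pre \<tau>"] by auto
  qed auto
  have I: "I = supp_ideal ?U1"
    using rename_fst_supp_ideal[where 'k = 'k, OF r U] A img by (simp add: inj_below_def inj_on_pol_base)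
  have D: "alexander_dual {1..n} I = supp_ideal (dual_upset {1..n} ?U1)"
    unfolding I by (rule alexander_dual_supp_ideal[OF _ U1]) simp
  have D': "alexander_dual ?V I' = supp_ideal ?W"
    unfolding I' by (rule alexander_dual_supp_ideal[OF fin U])
  \<comment> \<open>Preimages commute with complements, so the image of the dual is described by the
    dual of \<open>?U1\<close>.\<close>
  have "?pre ({1..n} - \<rho>) = ?V - ?pre \<rho>" for \<rho> by (auto simp: pol_vars_def)
  then have dual: "{\<rho>. \<rho> \<subseteq> {1..n} \<and> ?pre \<rho> \<in> ?W} = dual_upset {1..n} ?U1"
    by (auto simp: dual_upset_def)
  have "rename fst ` (supp_ideal ?W :: (nat \<times> nat, 'k) mpoly set) = supp_ideal (dual_upset {1..n} ?U1)"
    unfolding dual[symmetric]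
    by (rule rename_fst_supp_ideal[OF r W]) (use AW in \<open>simp_all add: inj_below_def inj_on_pol_base\<close>)
  moreover have "regular TYPE('k) ?W" by (rule regular_if_inj[OF W AW BW])
  ultimately show ?thesis
    unfolding polarization_def D D' psubst_eq_rename
    using r W upset_dual[OF U1] sqfree_monomial_ideal_iff[OF fin, of "supp_ideal ?W"]
      regular_sequence_iff_regular[where 'k = 'k, OF W pol_sequence_eq]
    by (auto intro!: monomial_ideal_supp_ideal)
qed

end
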